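(* Let $A_i:\mathbb{R}_{\ge0}\to\mathbb{R}^{n\times n}$, $i=0,\ldots,N$, and $\mu:\mathbb{R}_{\ge0}\to\mathbb{R}$ be piecewise continuous and bounded, and consider the matrix-valued system $$\dot X(t)=A_0(t)X(t)+X(t)A_0(t)^T+\sum_{i=1}^N A_i(t)X(t)A_i(t)^T+\mu(t)X(t),\quad t\ge t_0,\qquad X(t_0)=X_0\in\mathbb{S}^n_{\succeq0}.\qquad(\ast)$$ Let $\mathcal{C}_t^*(P)=A_0(t)^TP+PA_0(t)+\sum_{i=1}^NA_i(t)^TPA_i(t)+\mu(t)P$ for $P\in\mathbb{S}^n$. The following statements are equivalent: (a) The system $(\ast)$ is uniformly exponentially stable. (b) There exist a differentiable matrix-valued function $P:\mathbb{R}_{\ge0}\to\mathbb{S}^n_{\succ0}$ and a continuous matrix-valued function $Q:\mathbb{R}_{\ge0}\to\mathbb{S}^n_{\succ0}$ such that $\alpha_1I\preceq P(t)\preceq\alpha_2I$, $\beta_1I\preceq Q(t)\preceq\beta_2I$ and the Lyapunov differential equation $$\dot P(t)+\mathcal{C}_t^*(P(t))+Q(t)=0$$ hold for all $t\ge0$ and for some scalars $\alpha_1,\alpha_2,\beta_1,\beta_2>0$. (c) There exists a differentiable matrix-valued function $P:\mathbb{R}_{\ge0}\to\mathbb{S}^n_{\succ0}$ such that $\alpha_1I\preceq P(t)\preceq\alpha_2I$ and the Lyapunov differential inequality $$\dot P(t)+\mathcal{C}_t^*(P(t))\preceq-\alpha_3I$$ hold for all $t\ge0$ and for some scalars $\a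lpha_1,\alpha_2,\alpha_3>0$.
   Context: $\mathbb{S}^n$, $\mathbb{S}^n_{\succeq0}$, $\mathbb{S}^n_{\succ0}$ denote the real symmetric, symmetric positive semidefinite and symmetric positive definite $n\times n$ matrices; $\preceq$ is the Loewner order. The system is (globally) uniformly exponentially stable if there exist scalars $\alpha>0$, $\beta\ge1$ such that $\|X(t)\|\le\beta e^{-\alpha(t-t_0)}\|X_0\|$ for all $t\ge t_0$, all $t_0\ge0$ and all $X_0\in\mathbb{S}^n_{\succeq0}$, where $\|\cdot\|$ is a matrix norm.
   Formalization: In (b) and (c), P is continuous on all t≥0, but its differentiability and the Lyapunov equation or inequality are required only at times where all A_i and μ are continuous; read at every t, (a)⇒(b) fails when A_0 jumps, since a derivative has no jump discontinuity. *)

theory Defs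
  imports "HOL-Analysis.Analysis"
begin

definition sym_mat :: "real ^ 'n ^ 'n \<Rightarrow> bool" where
  "sym_mat M \<longleftrightarrow> transpose M = M"

definition psd :: "real ^ 'n ^ 'n \<Rightarrow> bool" where
  "psd M \<longleftrightarrow> sym_mat M \<and> (\<forall>x. 0 \<le> x \<bullet> (M *v x))"

definition pd :: "real ^ 'n ^ 'n \<Rightarrow> bool" where
  "pd M \<longleftrightarrow> sym_mat M \<and> (\<forall>x. x \<noteq> 0 \<longrightarrow> 0 < x \<bullet> (M *v x))"

definition loewner_le :: "real ^ 'n ^ 'n \<Rightarrow> real ^ 'n ^ 'n \<Rightarrow> bool"  (infix \<open>\<preceq>\<^sub>L\<close> 50) where
  "M \<preceq>\<^sub>L K \<longleftrightarrow> psd (K - M)"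

text \<open>An arbitrary norm on the matrix space. Submultiplicativity is not required, so
  submultiplicative norms are a special case.\<close>

definition matrix_norm :: "(real ^ 'n ^ 'n \<Rightarrow> real) \<Rightarrow> bool" where
  "matrix_norm \<nu> \<longleftrightarrow>
     (\<forall>M. 0 \<le> \<nu> M) \<and> (\<forall>M. \<nu> M = 0 \<longleftrightarrow> M = 0) \<and>
     (\<forall>c M. \<nu> (c *\<^sub>R M) = \<bar>c\<bar> * \<nu> M) \<and>
     (\<forall>M K. \<nu> (M + K) \<le> \<nu> M + \<nu> K)"

text \<open>Functions on the half-line are total functions on the reals; only their values
  at \<open>t \<ge> 0\<close> are used. Piecewise continuity: finitely many discontinuities in every
  bounded interval, with finite one-sided limits everywhere. The value at a
  discontinuity is arbitrary.\<close>

definition piecewise_continuous :: "(real \<Rightarrow> 'a::real_normed_vector) \<Rightarrow> bool" where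
  "piecewise_continuous f \<longleftrightarrow>
     (\<forall>T. finite {t \<in> {0..T}. \<not> continuous (at t within {0..}) f}) \<and>
     (\<forall>t\<ge>0. \<exists>l. (f \<longlongrightarrow> l) (at_right t)) \<and>
     (\<forall>t>0. \<exists>l. (f \<longlongrightarrow> l) (at_left t))"

definition sys_op ::
  "(nat \<Rightarrow> real \<Rightarrow> real ^ 'n ^ 'n) \<Rightarrow> nat \<Rightarrow> (real \<Rightarrow> real) \<Rightarrow> real \<Rightarrow> real ^ 'n ^ 'n \<Rightarrow> real ^ 'n ^ 'n" where
  "sys_op A N \<mu> t X =
     A 0 t ** X + X ** transpose (A 0 t)
       + (\<Sum>i=1..N. A i t ** X ** transpose (A i t)) + \<mu> t *\<^sub>R X"

definition adj_op ::
  "(nat \<Rightarrow> real \<Rightarrow> real ^ 'n ^ 'n) \<Rightarrow> nat \<Rightarrow> (real \<Rightarrow> real) \<Rightarrow> real \<Rightarrow> real ^ 'n ^ 'n \<Rightarrow> real ^ 'n ^ 'n" where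
  "adj_op A N \<mu> t P =
     transpose (A 0 t) ** P + P ** A 0 t
       + (\<Sum>i=1..N. transpose (A i t) ** P ** A i t) + \<mu> t *\<^sub>R P"

text \<open>Differential equations and inequalities with piecewise continuous coefficients are
  understood as usual: the unknown is continuous everywhere, and it is differentiable and
  satisfies the relation at every time at which all the coefficients are continuous. A
  function cannot in general be differentiable and satisfy the equation at a jump of the
  coefficients, because derivatives have no jump discontinuities. If the coefficients are
  continuous, all times are regular.\<close>

definition regular_time ::
  "(nat \<Rightarrow> real \<Rightarrow> real ^ 'n ^ 'n) \<Rightarrow> nat \<Rightarrow> (real \<Rightarrow> real) \<Rightarrow> real \<Rightarrow> bool" where
  "regular_time A N \<mu> t \<longleftrightarrow>
     (\<forall>i\<le>N. continuous (at t within {0..}) (A i)) \<and> continuous (at t within {0..}) \<mu>"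

definition solution ::
  "(nat \<Rightarrow> real \<Rightarrow> real ^ 'n ^ 'n) \<Rightarrow> nat \<Rightarrow> (real \<Rightarrow> real) \<Rightarrow> real \<Rightarrow> real ^ 'n ^ 'n
     \<Rightarrow> (real \<Rightarrow> real ^ 'n ^ 'n) \<Rightarrow> bool" where
  "solution A N \<mu> t0 X0 X \<longleftrightarrow>
     X t0 = X0 \<and> continuous_on {t0..} X \<and>
     (\<forall>t\<ge>t0. regular_time A N \<mu> t \<longrightarrow>
        (X has_vector_derivative sys_op A N \<mu> t (X t)) (at t within {t0..}))"

definition uniformly_exponentially_stable ::
  "(real ^ 'n ^ 'n \<Rightarrow> real) \<Rightarrow> (nat \<Rightarrow> real \<Rightarrow> real ^ 'n ^ 'n) \<Rightarrow> nat \<Rightarrow> (real \<Rightarrow> real) \<Rightarrow> bool" where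
  "uniformly_exponentially_stable \<nu> A N \<mu> \<longleftrightarrow>
     (\<exists>\<alpha>>0. \<exists>\<beta>\<ge>1. \<forall>t0\<ge>0. \<forall>X0 X. psd X0 \<longrightarrow> solution A N \<mu> t0 X0 X \<longrightarrow>
        (\<forall>t\<ge>t0. \<nu> (X t) \<le> \<beta> * exp (- \<alpha> * (t - t0)) * \<nu> X0))"

text \<open>\<open>P'\<close> is the derivative of \<open>P\<close> on the half-line (one-sided at \<open>0\<close>), in the above sense.\<close>

definition differentiable_with ::
  "(nat \<Rightarrow> real \<Rightarrow> real ^ 'n ^ 'n) \<Rightarrow> nat \<Rightarrow> (real \<Rightarrow> real)
     \<Rightarrow> (real \<Rightarrow> real ^ 'n ^ 'n) \<Rightarrow> (real \<Rightarrow> real ^ 'n ^ 'n) \<Rightarrow> bool" where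
  "differentiable_with A N \<mu> P P' \<longleftrightarrow>
     continuous_on {0..} P \<and>
     (\<forall>t\<ge>0. regular_time A N \<mu> t \<longrightarrow> (P has_vector_derivative P' t) (at t within {0..}))"

definition lyapunov_equation_cond ::
  "(nat \<Rightarrow> real \<Rightarrow> real ^ 'n ^ 'n) \<Rightarrow> nat \<Rightarrow> (real \<Rightarrow> real) \<Rightarrow> bool" where
  "lyapunov_equation_cond A N \<mu> \<longleftrightarrow>
     (\<exists>P P' Q. \<exists>\<alpha>1>0. \<exists>\<alpha>2>0. \<exists>\<beta>1>0. \<exists>\<beta>2>0.
        differentiable_with A N \<mu> P P' \<and> continuous_on {0..} Q \<and>
        (\<forall>t\<ge>0. pd (P t) \<and> pd (Q t) \<and>
           \<alpha>1 *\<^sub>R mat 1 \<preceq>\<^sub>L P t \<and> P t \<preceq>\<^sub>L \<alpha>2 *\<^sub>R mat 1 \<and>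
           \<beta>1 *\<^sub>R mat 1 \<preceq>\<^sub>L Q t \<and> Q t \<preceq>\<^sub>L \<beta>2 *\<^sub>R mat 1) \<and>
        (\<forall>t\<ge>0. regular_time A N \<mu> t \<longrightarrow> P' t + adj_op A N \<mu> t (P t) + Q t = 0))"

definition lyapunov_inequality_cond ::
  "(nat \<Rightarrow> real \<Rightarrow> real ^ 'n ^ 'n) \<Rightarrow> nat \<Rightarrow> (real \<Rightarrow> real) \<Rightarrow> bool" where
  "lyapunov_inequality_cond A N \<mu> \<longleftrightarrow>
     (\<exists>P P'. \<exists>\<alpha>1>0. \<exists>\<alpha>2>0. \<exists>\<alpha>3>0.
        differentiable_with A N \<mu> P P' \<and>
        (\<forall>t\<ge>0. pd (P t) \<and> \<alpha>1 *\<^sub>R mat 1 \<preceq>\<^sub>L P t \<and> P t \<preceq>\<^sub>L \<alpha>2 *\<^sub>R mat 1) \<and>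
        (\<forall>t\<ge>0. regular_time A N \<mu> t \<longrightarrow>
           P' t + adj_op A N \<mu> t (P t) \<preceq>\<^sub>L (- \<alpha>3) *\<^sub>R mat 1))"

end

theory Submission
  imports Defs
begin

text \<open>
  Solutions stay in the cone of positive semidefinite matrices, and \<open>P \<bullet> X = trace (P X)\<close> is
  nonnegative for \<open>P\<close>, \<open>X\<close> in the cone. Hence, under the inequality, \<open>V(t) = P(t) \<bullet> X(t)\<close> is comparable
  to the trace of \<open>X(t)\<close> and satisfies \<open>V' \<le> - (\<alpha>\<^sub>3/\<alpha>\<^sub>2) V\<close> off a locally finite set, so it decays
  exponentially. Conversely, if the system is stable, let \<open>P(t) \<bullet> X(t)\<close> be the integral of the
  trace of \<open>X\<close> over \<open>[t, \<infinity>)\<close>; this \<open>P\<close> solves the Lyapunov equation with \<open>Q = I\<close>. Stability bounds it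
  from above, and since a solution cannot shrink faster than \<open>e\<^bsup>-Kt\<^esup>\<close>, it is bounded from below.
\<close>

section \<open>Linear differential equations with finitely many irregular times\<close>

text \<open>The coefficients may jump, and no differential relation is assumed at a jump. All
  differential arguments therefore run through integrals or monotonicity statements that tolerate
  finitely many exceptional times in a bounded interval, and solutions are built from an integral
  equation. Stability says something only about solutions that exist and start in the cone. The
  converse direction must therefore construct solutions itself, and must pass from semidefinite to
  arbitrary initial values to obtain a linear functional of the initial value. The function
  \<open>P\<close> is not obtained by differentiating its integral formula, which would call for the
  adjoint of a two-parameter transition operator; it is defined as a solution of a linear
  differential equation and compared with the integral along the flow afterwards. The constant
  \<open>K\<close> of the overview is a uniform bound for the operator norm of
  \<open>sys_op\<close>; it comes from the bounds on the coefficients and limits growth and decay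
  alike.\<close>

lemma at_within_Icc_eq_at_within_Ici:
  fixes a t T :: real
  assumes "t < T"
  shows "at t within {a..T} = at t within {a..}"
  by (rule at_within_nhd[where S="{..<T}"]) (use assms in auto)

lemma continuous_on_Ici_if_Icc:
  fixes f :: "real \<Rightarrow> 'a::topological_space"
  assumes "\<And>T. continuous_on {a..T} f"
  shows "continuous_on {a..} f"
  unfolding continuous_on_eq_continuous_within
proof
  fix t assume "t \<in> {a..}"
  then have "continuous (at t within {a..t + 1}) f"
    using assms[of "t + 1"] by (auto simp: continuous_on_eq_continuous_within)
  then show "continuous (at t within {a..}) f"
    by (simp add: at_within_Icc_eq_at_within_Ici)
qed

lemma has_vector_derivative_at_if_within_Ici:
  assumes "(f has_vector_derivative f') (at t within {a..})" "(a::real) < t"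
  shows "(f has_vector_derivative f') (at t)"
proof -
  have "at t within {a..} = at t"
    using assms(2) by (intro at_within_interior) simp
  with assms(1) show ?thesis by simp
qed

lemma has_integral_exp_decay:
  assumes "a > 0"
  shows "((\<lambda>s::real. exp (- a * (s - t))) has_integral 1 / a) {t..}"
proof -
  have "((\<lambda>s. exp (a * t) * exp (- a * s)) has_integral exp (a * t) * (exp (- a * t) / a)) {t..}"
    by (intro has_integral_mult_right has_integral_exp_minus_to_infinity assms)
  moreover have "exp (a * t) * exp (- a * s) = exp (- a * (s - t))" for s
    by (simp add: algebra_simps flip: exp_add)
  moreover have "exp (a * t) * (exp (- a * t) / a) = 1 / a"
    by (simp flip: exp_add)
  ultimately show ?thesis by simp
qed

section \<open>Comparison estimates with finitely many exceptional times\<close>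

lemma has_real_derivative_inner:
  fixes f g :: "real \<Rightarrow> 'a::real_inner"
  assumes "(f has_vector_derivative f') (at t within S)"
    and "(g has_vector_derivative g') (at t within S)"
  shows "((\<lambda>s. f s \<bullet> g s) has_real_derivative f t \<bullet> g' + f' \<bullet> g t) (at t within S)"
  unfolding has_real_derivative_iff_has_vector_derivative
  by (rule bounded_bilinear.has_vector_derivative[OF bounded_bilinear_inner assms])

lemma nondecreasing_off_finite:
  fixes f :: "real \<Rightarrow> real"
  assumes "a \<le> b" "finite S" "continuous_on {a..b} f"
    and der: "\<And>t. t \<in> {a<..<b} - S \<Longrightarrow> \<exists>D\<ge>0. (f has_real_derivative D) (at t)"
  shows "f a \<le> f b"
proof -
  obtain D where D: "\<And>t. t \<in> {a<..<b} - S \<Longrightarrow> D t \<ge> 0 \<and> (f has_real_derivative D t) (at t)"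
    using der by metis
  \<comment> \<open>At the endpoints and on \<open>S\<close>, where no derivative is given, the
    default 0 keeps \<open>g\<close> nonnegative; the fundamental theorem tolerates these points
    because \<open>f\<close> is continuous there.\<close>
  define g where "g t = (if t \<in> {a<..<b} - S then D t else 0)" for t
  have "(g has_integral (f b - f a)) {a..b}"
    by (rule fundamental_theorem_of_calculus_interior_strong[of S])
      (use assms D in \<open>auto simp: g_def has_real_derivative_iff_has_vector_derivative\<close>)
  then have "0 \<le> f b - f a"
    by (rule has_integral_nonneg) (use D in \<open>auto simp: g_def\<close>)
  then show ?thesis by simp
qed

text \<open>The integrating factor \<open>exp (- k * (t - a))\<close> turns the differential
  inequality into monotonicity. The rate \<open>k\<close> may have either sign, and upper estimates
  are obtained by applying the lemma to \<open>- u\<close>.\<close>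

lemma gronwall_off_finite:
  fixes u :: "real \<Rightarrow> real"
  assumes "a \<le> b" "finite S" "continuous_on {a..b} u"
    and der: "\<And>t. t \<in> {a<..<b} - S \<Longrightarrow> \<exists>D\<ge>k * u t. (u has_real_derivative D) (at t)"
  shows "exp (k * (b - a)) * u a \<le> u b"
proof -
  define f where "f t = exp (- k * (t - a)) * u t" for t
  have "f a \<le> f b"
  proof (rule nondecreasing_off_finite[OF assms(1,2)])
    show "continuous_on {a..b} f"
      unfolding f_def by (intro continuous_intros assms)
    fix t assume "t \<in> {a<..<b} - S"
    then obtain D where D: "D \<ge> k * u t" "(u has_real_derivative D) (at t)"
      using der by blast
    have "(f has_real_derivative exp (- k * (t - a)) * (D - k * u t)) (at t)"
      unfolding f_def by (auto intro!: derivative_eq_intros D simp: algebra_simps)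
    then show "\<exists>D\<ge>0. (f has_real_derivative D) (at t)"
      using D(1) by (intro exI[of _ "exp (- k * (t - a)) * (D - k * u t)"]) auto
  qed
  then have "u a \<le> exp (- k * (b - a)) * u b"
    by (simp add: f_def)
  then have "exp (k * (b - a)) * u a \<le> exp (k * (b - a)) * (exp (- k * (b - a)) * u b)"
    by (intro mult_left_mono) auto
  also have "\<dots> = u b"
    by (simp flip: mult.assoc exp_add)
  finally show ?thesis .
qed

section \<open>Existence of solutions through an integral equation\<close>

lemma integrable_bounded_continuous_off_finite:
  fixes g :: "real \<Rightarrow> 'a::euclidean_space"
  assumes "finite S" "continuous_on ({a..b} - S) g"
    and "\<And>t. t \<in> {a..b} \<Longrightarrow> norm (g t) \<le> B"
  shows "g integrable_on {a..b}"
proof (rule integrable_spike_set)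
  show "g integrable_on {a..b} - S"
  proof (rule measurable_bounded_by_integrable_imp_integrable)
    show meas: "{a..b} - S \<in> sets lebesgue"
      using assms(1) by (intro sets.Diff) (auto simp: negligible_finite negligible_imp_sets)
    show "g \<in> borel_measurable (lebesgue_on ({a..b} - S))"
      by (rule continuous_imp_measurable_on_sets_lebesgue[OF assms(2) meas])
    have "(\<lambda>_. B) integrable_on {a..b}"
      by (rule integrable_const_ivl)
    then show "(\<lambda>_. B) integrable_on {a..b} - S"
      by (rule integrable_spike_set)
        (auto intro!: negligible_subset[OF negligible_finite[OF assms(1)]])
  qed (use assms in auto)
qed (auto intro!: negligible_subset[OF negligible_finite[OF assms(1)]])

lemma integral_has_vector_derivative_within_Ici:
  fixes g :: "real \<Rightarrow> 'a::banach"
  assumes "\<And>T. g integrable_on {a..T}" "a \<le> t" "continuous (at t within {a..}) g"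
  shows "((\<lambda>u. integral {a..u} g) has_vector_derivative g t) (at t within {a..})"
proof -
  have "((\<lambda>u. integral {a..u} g) has_vector_derivative g t) (at t within {a..t + 1} - {})"
    by (rule integral_has_vector_derivative_continuous_at)
      (use assms in \<open>auto simp: at_within_Icc_eq_at_within_Ici\<close>)
  then show ?thesis
    by (simp add: at_within_Icc_eq_at_within_Ici)
qed

text \<open>Picard iteration: as \<open>L t\<close> is linear, the differences of successive
  iterates obey a recursion of their own, and the solution is their sum. Integrability along
  continuous functions is assumed in place of continuity of \<open>L\<close> in time, which fails at
  jumps.\<close>

lemma volterra_solution_exists:
  fixes L :: "real \<Rightarrow> 'a \<Rightarrow> 'a::euclidean_space"
  assumes lin: "\<And>t. linear (L t)" and "K > 0"
    and bnd: "\<And>t x. 0 \<le> t \<Longrightarrow> norm (L t x) \<le> K * norm x"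
    and int: "\<And>x T. continuous_on {0..} x \<Longrightarrow> (\<lambda>s. L s (x s)) integrable_on {0..T}"
    and h: "continuous_on {0..} h"
  obtains x where "continuous_on {0..} x"
    "\<And>t. 0 \<le> t \<Longrightarrow> x t = h t + integral {0..t} (\<lambda>s. L s (x s))"
proof -
  \<comment> \<open>The terms of the Neumann series of the integral operator, applied to
    \<open>h\<close>.\<close>
  define d where "d = rec_nat h (\<lambda>_ g t. integral {0..t} (\<lambda>s. L s (g s)))"
  have d_0: "d 0 = h" and d_Suc: "\<And>n t. d (Suc n) t = integral {0..t} (\<lambda>s. L s (d n s))"
    by (simp_all add: d_def)
  have d_cont: "continuous_on {0..} (d n)" for n
  proof (induction n)
    case (Suc n)
    have "continuous_on {0..T} (\<lambda>t. integral {0..t} (\<lambda>s. L s (d n s)))" for T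
      by (intro indefinite_integral_continuous_1 int Suc)
    then have "continuous_on {0..} (\<lambda>t. integral {0..t} (\<lambda>s. L s (d n s)))"
      by (rule continuous_on_Ici_if_Icc)
    then show ?case by (simp add: d_Suc[abs_def])
  qed (simp add: d_0 h)
  \<comment> \<open>The weight \<open>exp (2 * K * t)\<close> gains a factor 1/2 with each
    integration, so the series is dominated by a geometric one on every interval, however long.
    \<open>M\<close> depends on \<open>T\<close> since \<open>h\<close> is bounded only on compact
    intervals.\<close>
  have "\<exists>M\<ge>0. \<forall>t\<in>{0..T}. \<forall>n. norm (d n t) \<le> M * exp (2 * K * t) / 2 ^ n" for T
  proof -
    have "compact (h ` {0..T})"
      using h by (intro compact_continuous_image continuous_on_subset[OF h]) auto
    then obtain M where M: "\<And>t. t \<in> {0..T} \<Longrightarrow> norm (h t) \<le> M" and "M \<ge> 0"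
      using compact_imp_bounded bounded_pos by (metis imageI less_imp_le)
    have "norm (d n t) \<le> M * exp (2 * K * t) / 2 ^ n" if "t \<in> {0..T}" for n t
      using that
    proof (induction n arbitrary: t)
      case 0
      have "norm (h t) \<le> M * 1" using M 0 by simp
      also have "\<dots> \<le> M * exp (2 * K * t)"
        using \<open>M \<ge> 0\<close> \<open>K > 0\<close> 0 by (intro mult_left_mono) auto
      finally show ?case by (simp add: d_0)
    next
      case (Suc n)
      define c where "c = M / 2 ^ Suc n"
      have I: "((\<lambda>s. c * (2 * K * exp (2 * K * s))) has_integral
          (c * exp (2 * K * t) - c * exp (2 * K * 0))) {0..t}"
        using Suc.prems
        by (intro fundamental_theorem_of_calculus)
          (auto intro!: derivative_eq_intros simp flip: has_real_derivative_iff_has_vector_derivative)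
      have "norm (d (Suc n) t) \<le> integral {0..t} (\<lambda>s. c * (2 * K * exp (2 * K * s)))"
        unfolding d_Suc
      proof (rule integral_norm_bound_integral)
        fix s assume "s \<in> {0..t}"
        then have "norm (L s (d n s)) \<le> K * (M * exp (2 * K * s) / 2 ^ n)"
          using Suc \<open>K > 0\<close> by (intro order_trans[OF bnd] mult_left_mono) auto
        then show "norm (L s (d n s)) \<le> c * (2 * K * exp (2 * K * s))"
          by (simp add: c_def algebra_simps)
      qed (use I d_cont int in \<open>auto simp: integrable_on_def\<close>)
      also have "\<dots> = c * exp (2 * K * t) - c"
        using integral_unique[OF I] by simp
      also have "\<dots> \<le> c * exp (2 * K * t)"
        using \<open>M \<ge> 0\<close> by (simp add: c_def)
      finally show ?case by (simp add: c_def)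
    qed
    then show ?thesis using \<open>M \<ge> 0\<close> by blast
  qed
  then obtain M where M0: "\<And>T. M T \<ge> 0"
    and M: "\<And>T t n. t \<in> {0..T} \<Longrightarrow> norm (d n t) \<le> M T * exp (2 * K * t) / 2 ^ n"
    by metis
  define B where "B T = M T * exp (2 * K * T)" for T
  have B: "norm (d n t) \<le> B T * (1 / 2) ^ n" if "t \<in> {0..T}" for n t T
  proof -
    have "M T * exp (2 * K * t) / 2 ^ n \<le> B T / 2 ^ n"
      unfolding B_def using that M0 \<open>K > 0\<close> by (intro divide_right_mono mult_left_mono) auto
    then show ?thesis using M[OF that, of n] by (simp add: power_divide)
  qed
  have geo: "summable (\<lambda>n. B T * (1 / 2) ^ n)" for T
    by (intro summable_mult summable_geometric) simp
  define x where "x t = (\<Sum>n. d n t)" for t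
  have unif: "uniform_limit {0..T} (\<lambda>n t. \<Sum>i<n. d i t) x sequentially" for T
    unfolding x_def by (rule Weierstrass_m_test[OF B geo])
  have "continuous_on {0..T} x" for T
    by (rule uniform_limit_theorem[OF _ unif])
      (auto intro!: always_eventually continuous_on_sum continuous_on_subset[OF d_cont])
  then have x_cont: "continuous_on {0..} x"
    by (rule continuous_on_Ici_if_Icc)
  \<comment> \<open>Both sides are limits of the partial sums: the left by definition, the right by
    passing to the limit under the integral in the recursion \<open>S_Suc\<close>.\<close>
  have "x t = h t + integral {0..t} (\<lambda>s. L s (x s))" if "0 \<le> t" for t
  proof (rule LIMSEQ_unique)
    define S where "S n s = (\<Sum>i<n. d i s)" for n s
    have S_cont: "continuous_on {0..} (S n)" for n
      unfolding S_def by (intro continuous_intros d_cont)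
    have S_lim: "(\<lambda>n. S n s) \<longlonglongrightarrow> x s" if "0 \<le> s" for s
      unfolding S_def by (rule tendsto_uniform_limitI[OF unif[of s]]) (use that in auto)
    have S_Suc: "S (Suc n) t = h t + integral {0..t} (\<lambda>s. L s (S n s))" for n
    proof -
      have "integral {0..t} (\<lambda>s. L s (S n s)) = integral {0..t} (\<lambda>s. \<Sum>i<n. L s (d i s))"
        by (simp add: S_def linear_sum[OF lin])
      also have "\<dots> = (\<Sum>i<n. d (Suc i) t)"
        by (subst integral_sum) (auto intro!: int d_cont simp: d_Suc)
      finally show ?thesis
        by (simp add: S_def sum.lessThan_Suc_shift d_0 del: sum.lessThan_Suc)
    qed
    show "(\<lambda>n. S (Suc n) t) \<longlonglongrightarrow> x t"
      using S_lim[OF that] by (rule LIMSEQ_Suc)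
    have "(\<lambda>n. integral {0..t} (\<lambda>s. L s (S n s))) \<longlonglongrightarrow> integral {0..t} (\<lambda>s. L s (x s))"
    proof (rule dominated_convergence)
      fix n s assume s: "s \<in> {0..t}"
      have "norm (S n s) \<le> (\<Sum>i<n. B t * (1 / 2) ^ i)"
        unfolding S_def by (rule order_trans[OF norm_sum sum_mono[OF B[OF s]]])
      also have "\<dots> \<le> (\<Sum>i. B t * (1 / 2) ^ i)"
        by (rule sum_le_suminf[OF geo]) (auto simp: B_def M0)
      finally show "norm (L s (S n s)) \<le> K * (\<Sum>i. B t * (1 / 2) ^ i)"
        using s \<open>K > 0\<close> by (intro order_trans[OF bnd] mult_left_mono) auto
    next
      fix s assume "s \<in> {0..t}"
      then show "(\<lambda>n. L s (S n s)) \<longlonglongrightarrow> L s (x s)"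
        using lin S_lim by (intro bounded_linear.tendsto[of "L s"]) (auto simp: linear_conv_bounded_linear)
    qed (auto intro!: int S_cont)
    then show "(\<lambda>n. S (Suc n) t) \<longlonglongrightarrow> h t + integral {0..t} (\<lambda>s. L s (x s))"
      unfolding S_Suc by (intro tendsto_intros)
  qed
  with x_cont show ?thesis by (rule that)
qed

text \<open>This is the Volterra equation with \<open>h t = x0 + t *\<^sub>R b\<close>; its integral
  can be differentiated wherever the integrand is continuous, that is, at the times in
  \<open>R\<close>. The constant \<open>b\<close> makes room for the inhomogeneous Lyapunov
  equation.\<close>

lemma affine_ode_solution_exists:
  fixes L :: "real \<Rightarrow> 'a \<Rightarrow> 'a::euclidean_space" and R :: "real \<Rightarrow> bool"
  assumes lin: "\<And>t. linear (L t)" and "K > 0"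
    and bnd: "\<And>t x. 0 \<le> t \<Longrightarrow> norm (L t x) \<le> K * norm x"
    and fin: "\<And>T. finite {t \<in> {0..T}. \<not> R t}"
    and cont: "\<And>x t. continuous_on {0..} x \<Longrightarrow> 0 \<le> t \<Longrightarrow> R t \<Longrightarrow>
      continuous (at t within {0..}) (\<lambda>s. L s (x s))"
  obtains x where "x 0 = x0" "continuous_on {0..} x"
    "\<And>t. 0 \<le> t \<Longrightarrow> R t \<Longrightarrow> (x has_vector_derivative (L t (x t) + b)) (at t within {0..})"
proof -
  have int: "(\<lambda>s. L s (x s)) integrable_on {0..T}" if x: "continuous_on {0..} x" for x T
  proof -
    have "compact (x ` {0..T})"
      by (intro compact_continuous_image continuous_on_subset[OF x]) auto
    then obtain M where M: "\<And>t. t \<in> {0..T} \<Longrightarrow> norm (x t) \<le> M"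
      using compact_imp_bounded bounded_pos by (metis imageI)
    show ?thesis
    proof (rule integrable_bounded_continuous_off_finite[OF fin[of T], of _ _ _ "K * M"])
      show "continuous_on ({0..T} - {t \<in> {0..T}. \<not> R t}) (\<lambda>s. L s (x s))"
        unfolding continuous_on_eq_continuous_within
        by (auto intro!: continuous_within_subset[OF cont[OF x]])
      show "norm (L t (x t)) \<le> K * M" if "t \<in> {0..T}" for t
        using that \<open>K > 0\<close> by (intro order_trans[OF bnd] mult_left_mono M) auto
    qed
  qed
  have h: "continuous_on {0..} (\<lambda>t. x0 + t *\<^sub>R b)"
    by (intro continuous_intros)
  obtain x where x: "continuous_on {0..} x"
    "\<And>t. 0 \<le> t \<Longrightarrow> x t = x0 + t *\<^sub>R b + integral {0..t} (\<lambda>s. L s (x s))"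
    using volterra_solution_exists[where L = L and K = K, OF lin \<open>K > 0\<close> bnd int h] by blast
  have "x 0 = x0"
    using x(2)[of 0] by simp
  moreover have "(x has_vector_derivative (L t (x t) + b)) (at t within {0..})"
    if "0 \<le> t" "R t" for t
  proof -
    have "((\<lambda>u. integral {0..u} (\<lambda>s. L s (x s))) has_vector_derivative L t (x t))
        (at t within {0..})"
      using that by (intro integral_has_vector_derivative_within_Ici int x cont)
    then have "((\<lambda>t. x0 + t *\<^sub>R b + integral {0..t} (\<lambda>s. L s (x s))) has_vector_derivative
        (L t (x t) + b)) (at t within {0..})"
      by (auto intro!: derivative_eq_intros simp: add.commute)
    then show ?thesis
      by (rule has_vector_derivative_transform[rotated 2]) (use that x(2) in auto)
  qed
  ultimately show ?thesis
    using that x(1) by blast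
qed

section \<open>Positive semidefinite matrices\<close>

lemma inner_transpose_transpose:
  fixes M K :: "real ^ 'n ^ 'n"
  shows "transpose M \<bullet> transpose K = M \<bullet> K"
  by (simp add: inner_vec_def transpose_def) (rule sum.swap)

lemma norm_transpose:
  fixes M :: "real ^ 'n ^ 'n"
  shows "norm (transpose M) = norm M"
  by (simp add: norm_eq_sqrt_inner inner_transpose_transpose)

lemma inner_matrix_mult_left:
  fixes P A X :: "real ^ 'n ^ 'n"
  shows "P \<bullet> (A ** X) = (transpose A ** P) \<bullet> X"
proof -
  have "P \<bullet> (A ** X) = (\<Sum>i\<in>UNIV. \<Sum>j\<in>UNIV. \<Sum>k\<in>UNIV. P $ i $ j * A $ i $ k * X $ k $ j)"
    by (simp add: inner_vec_def matrix_matrix_mult_def sum_distrib_left mult.assoc)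
  also have "\<dots> = (\<Sum>i\<in>UNIV. \<Sum>k\<in>UNIV. \<Sum>j\<in>UNIV. P $ i $ j * A $ i $ k * X $ k $ j)"
    by (rule sum.cong[OF refl]) (rule sum.swap)
  also have "\<dots> = (\<Sum>k\<in>UNIV. \<Sum>i\<in>UNIV. \<Sum>j\<in>UNIV. P $ i $ j * A $ i $ k * X $ k $ j)"
    by (rule sum.swap)
  also have "\<dots> = (\<Sum>k\<in>UNIV. \<Sum>j\<in>UNIV. \<Sum>i\<in>UNIV. P $ i $ j * A $ i $ k * X $ k $ j)"
    by (rule sum.cong[OF refl]) (rule sum.swap)
  also have "\<dots> = (transpose A ** P) \<bullet> X"
    by (simp add: inner_vec_def matrix_matrix_mult_def transpose_def sum_distrib_right mult.commute
        mult.left_commute sum_distrib_left)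
  finally show ?thesis .
qed

lemma inner_matrix_mult_right:
  fixes P A X :: "real ^ 'n ^ 'n"
  shows "P \<bullet> (X ** A) = (P ** transpose A) \<bullet> X"
proof -
  have "P \<bullet> (X ** A) = transpose P \<bullet> (transpose A ** transpose X)"
    by (metis inner_transpose_transpose matrix_transpose_mul)
  also have "\<dots> = transpose (P ** transpose A) \<bullet> transpose X"
    by (simp add: inner_matrix_mult_left matrix_transpose_mul)
  finally show ?thesis
    by (simp add: inner_transpose_transpose)
qed

lemma transpose_add: "transpose (M + K) = transpose M + transpose (K :: real ^ 'n ^ 'n)"
  by (simp add: transpose_def vec_eq_iff)

lemma linear_transpose: "linear (transpose :: real ^ 'n ^ 'n \<Rightarrow> real ^ 'n ^ 'n)"
  by (rule linearI) (simp_all add: transpose_add transpose_scalar)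

lemma transpose_diff: "transpose (M - K) = transpose M - transpose (K :: real ^ 'n ^ 'n)"
  by (rule linear_diff[OF linear_transpose])

lemma bounded_linear_transpose: "bounded_linear (transpose :: real ^ 'n ^ 'n \<Rightarrow> real ^ 'n ^ 'n)"
  using linear_transpose by (simp add: linear_conv_bounded_linear)

lemma bounded_bilinear_matrix_mult:
  "bounded_bilinear ((**) :: real ^ 'n ^ 'n \<Rightarrow> real ^ 'n ^ 'n \<Rightarrow> real ^ 'n ^ 'n)"
  unfolding bilinear_conv_bounded_bilinear[symmetric] bilinear_def
  by (auto intro!: linearI
      simp: matrix_matrix_mult_def vec_eq_iff sum.distrib sum_distrib_left algebra_simps)

interpretation matrix_mult: bounded_bilinear
  "(**) :: real ^ 'n ^ 'n \<Rightarrow> real ^ 'n ^ 'n \<Rightarrow> real ^ 'n ^ 'n"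
  by (rule bounded_bilinear_matrix_mult)

text \<open>The rank-one matrix v v^T. Quadratic forms become inner products with it, so membership
  in the cone is a family of linear conditions on the matrix.\<close>

definition outer :: "real ^ 'n \<Rightarrow> real ^ 'n ^ 'n" where
  "outer v = (\<chi> i j. v $ i * v $ j)"

lemma inner_outer: "M \<bullet> outer v = v \<bullet> (M *v v)"
  by (simp add: outer_def inner_vec_def matrix_vector_mult_def sum_distrib_left algebra_simps)

lemma outer_mult_vector: "outer v *v w = (v \<bullet> w) *\<^sub>R v"
  by (simp add: outer_def vec_eq_iff inner_vec_def matrix_vector_mult_def sum_distrib_left algebra_simps)

lemma norm_outer: "norm (outer v) = (norm v)\<^sup>2"
proof -
  have "outer v \<bullet> outer v = ((norm v)\<^sup>2)\<^sup>2"
    by (simp add: inner_outer outer_mult_vector power2_norm_eq_inner)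
      (simp add: power2_eq_square)
  then show ?thesis
    unfolding norm_eq_sqrt_inner[of "outer v"] by (simp only: real_sqrt_abs abs_power2)
qed

lemma inner_mat_1_outer: "mat 1 \<bullet> outer v = (norm v)\<^sup>2"
  by (simp add: inner_outer power2_norm_eq_inner)

lemma psd_iff_inner_outer: "psd M \<longleftrightarrow> transpose M = M \<and> (\<forall>v. 0 \<le> M \<bullet> outer v)"
  by (simp add: psd_def sym_mat_def inner_outer)

lemma psd_add: "psd M \<Longrightarrow> psd K \<Longrightarrow> psd (M + K)"
  by (simp add: psd_iff_inner_outer transpose_add inner_add_left)

lemma psd_scaleR: "0 \<le> c \<Longrightarrow> psd M \<Longrightarrow> psd (c *\<^sub>R M)"
  by (simp add: psd_iff_inner_outer transpose_scalar)

lemma psd_mat_1: "psd (mat 1)"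
  by (simp add: psd_iff_inner_outer inner_mat_1_outer)

lemma psd_outer: "psd (outer v)"
  by (auto simp: psd_def sym_mat_def outer_mult_vector inner_commute)
    (simp add: outer_def transpose_def vec_eq_iff mult.commute)

text \<open>The quadratic form of \<open>Y\<close> at \<open>v\<close> is at least
  \<open>- norm Y * (norm v)^2\<close>. The lemma writes a symmetric matrix as a difference of two
  semidefinite ones.\<close>

lemma sym_imp_psd_shift:
  assumes "transpose Y = Y" "norm Y \<le> c"
  shows "psd (Y + c *\<^sub>R mat 1)"
proof -
  have "0 \<le> (Y + c *\<^sub>R mat 1) \<bullet> outer v" for v
  proof -
    have "\<bar>Y \<bullet> outer v\<bar> \<le> norm Y * (norm v)\<^sup>2"
      using Cauchy_Schwarz_ineq2[of Y "outer v"] by (simp add: norm_outer)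
    also have "\<dots> \<le> c * (norm v)\<^sup>2"
      by (intro mult_right_mono assms) simp
    finally show ?thesis by (simp add: inner_add_left inner_mat_1_outer)
  qed
  with assms show ?thesis
    by (simp add: psd_iff_inner_outer transpose_add transpose_scalar)
qed

section \<open>Inequalities for semidefinite forms\<close>

lemma inner_sym_mat_vector:
  assumes "transpose M = (M :: real ^ 'n ^ 'n)"
  shows "x \<bullet> (M *v y) = y \<bullet> (M *v x)"
  using assms by (metis dot_lmul_matrix inner_commute transpose_matrix_vector)

lemma psd_Cauchy_Schwarz:
  assumes "psd M"
  shows "(x \<bullet> (M *v y))\<^sup>2 \<le> (x \<bullet> (M *v x)) * (y \<bullet> (M *v y))"
proof -
  define a b c where "a = x \<bullet> (M *v x)" and "b = x \<bullet> (M *v y)" and "c = y \<bullet> (M *v y)"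
  have nn: "0 \<le> z \<bullet> (M *v z)" for z
    using assms by (simp add: psd_def)
  have sym: "y \<bullet> (M *v x) = b"
    using assms inner_sym_mat_vector[of M y x] by (simp add: psd_def sym_mat_def b_def)
  have q: "0 \<le> a + 2 * r * b + r\<^sup>2 * c" for r
    using nn[of "x + r *\<^sub>R y"] sym
    by (simp add: a_def b_def c_def matrix_vector_right_distrib matrix_vector_mult_scaleR
        inner_add_left inner_add_right power2_eq_square algebra_simps)
  have "b\<^sup>2 \<le> a * c"
  proof (cases "c = 0")
    case True
    have "b = 0"
    proof (rule ccontr)
      assume "b \<noteq> 0"
      \<comment> \<open>For \<open>c = 0\<close> the expression is affine in \<open>r\<close>, and
        this \<open>r\<close> gives it the value -1.\<close>
      then show False
        using q[of "- (a + 1) / (2 * b)"] True by (simp add: field_simps)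
    qed
    with True show ?thesis by simp
  next
    case False
    then have "c > 0" using nn[of y] by (simp add: c_def)
    \<comment> \<open>The chosen \<open>r\<close> minimises the quadratic.\<close>
    then show ?thesis
      using q[of "- b / c"] by (simp add: field_simps power2_eq_square)
  qed
  then show ?thesis by (simp add: a_def b_def c_def)
qed

text \<open>Cauchy-Schwarz against the vector \<open>M *v v\<close> bounds the fourth power of its
  norm by a multiple of the vanishing form.\<close>

lemma psd_kernel:
  assumes "psd M" "v \<bullet> (M *v v) = 0"
  shows "M *v v = 0"
  using psd_Cauchy_Schwarz[OF assms(1), of "M *v v" v] assms(2) by simp

lemma axis_inner_mult_axis: "axis i 1 \<bullet> (M *v axis j 1) = (M :: real ^ 'n ^ 'n) $ i $ j"
  by (simp add: inner_axis' matrix_vector_mult_basis column_def)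

lemma psd_diag_nonneg: "psd M \<Longrightarrow> 0 \<le> M $ i $ i"
  by (metis psd_def axis_inner_mult_axis)

lemma psd_entry_bound:
  assumes "psd M"
  shows "(M $ i $ j)\<^sup>2 \<le> M $ i $ i * M $ j $ j"
  using psd_Cauchy_Schwarz[OF assms, of "axis i 1" "axis j 1"] by (simp add: axis_inner_mult_axis)

lemma inner_mat_1: "mat 1 \<bullet> M = (\<Sum>i\<in>UNIV. (M :: real ^ 'n ^ 'n) $ i $ i)"
  by (simp add: inner_vec_def mat_def if_distrib[of "\<lambda>x. x * _"] cong: if_cong)

text \<open>Squared entries are at most products of diagonal entries, and these products sum to the
  square of the trace. On the cone the trace, which is linear, can thus replace the norm.\<close>

lemma psd_norm_le_trace:
  assumes "psd M"
  shows "norm M \<le> mat 1 \<bullet> M"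
proof -
  have "M \<bullet> M = (\<Sum>i\<in>UNIV. \<Sum>j\<in>UNIV. (M $ i $ j)\<^sup>2)"
    by (simp add: inner_vec_def power2_eq_square)
  also have "\<dots> \<le> (\<Sum>i\<in>UNIV. \<Sum>j\<in>UNIV. M $ i $ i * M $ j $ j)"
    by (intro sum_mono psd_entry_bound assms)
  also have "\<dots> = (mat 1 \<bullet> M)\<^sup>2"
    by (simp add: inner_mat_1 power2_eq_square sum_product)
  finally have "(norm M)\<^sup>2 \<le> (mat 1 \<bullet> M)\<^sup>2"
    by (simp add: power2_norm_eq_inner)
  moreover have "0 \<le> mat 1 \<bullet> M"
    by (simp add: inner_mat_1 sum_nonneg psd_diag_nonneg[OF assms])
  ultimately show ?thesis
    by (rule power2_le_imp_le)
qed

text \<open>Gaussian elimination peels off one rank-one summand per nonzero diagonal entry of \<open>X\<close>.\<close>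

lemma psd_inner_nonneg:
  assumes "psd M" "psd X"
  shows "0 \<le> M \<bullet> X"
  using assms(2)
proof (induction "card {i. X $ i $ i \<noteq> 0}" arbitrary: X rule: less_induct)
  case less
  show ?case
  proof (cases "\<exists>i. X $ i $ i \<noteq> 0")
    case False
    then have "X $ i $ j = 0" for i j
      using psd_entry_bound[OF less.prems, of i j] by simp
    then have "X = 0" by (simp add: vec_eq_iff)
    then show ?thesis by simp
  next
    case True
    then obtain i where "X $ i $ i \<noteq> 0" by blast
    then have pos: "X $ i $ i > 0"
      using psd_diag_nonneg[OF less.prems, of i] by simp
    define w where "w = X *v axis i 1"
    have w_i: "w $ i = X $ i $ i"
      by (simp add: w_def matrix_vector_mult_basis column_def)
    \<comment> \<open>One elimination step with pivot \<open>X $ i $ i\<close>. That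
      \<open>Y\<close> is again semidefinite is Cauchy-Schwarz for \<open>X\<close> with the vectors
      \<open>v\<close> and \<open>axis i 1\<close>.\<close>
    define Y where "Y = X - (1 / X $ i $ i) *\<^sub>R outer w"
    have "psd Y"
      unfolding psd_iff_inner_outer
    proof (intro conjI allI)
      show "transpose Y = Y"
        using less.prems psd_outer[of w]
        by (simp add: Y_def psd_iff_inner_outer transpose_diff transpose_scalar)
      fix v
      have "outer w \<bullet> outer v = (v \<bullet> w)\<^sup>2"
        by (simp add: inner_outer outer_mult_vector power2_eq_square inner_commute)
      also have "\<dots> \<le> (X \<bullet> outer v) * X $ i $ i"
        using psd_Cauchy_Schwarz[OF less.prems, of v "axis i 1"]
        by (simp add: w_def inner_outer axis_inner_mult_axis)
      finally show "0 \<le> Y \<bullet> outer v"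
        using pos by (simp add: Y_def inner_diff_left field_simps)
    qed
    have Y_diag: "Y $ j $ j = X $ j $ j - (w $ j)\<^sup>2 / X $ i $ i" for j
      by (simp add: Y_def outer_def power2_eq_square)
    \<comment> \<open>Diagonal entries only decrease and stay nonnegative, so zeros persist while
      the pivot entry becomes a new zero.\<close>
    have "Y $ j $ j = 0" if "X $ j $ j = 0" for j
      using psd_diag_nonneg[OF \<open>psd Y\<close>, of j] that pos Y_diag[of j]
      by (simp add: divide_le_0_iff)
    moreover have "Y $ i $ i = 0"
      using pos by (simp add: Y_diag w_i power2_eq_square)
    ultimately have "{j. Y $ j $ j \<noteq> 0} \<subset> {j. X $ j $ j \<noteq> 0}"
      using \<open>X $ i $ i \<noteq> 0\<close> by blast
    then have "card {j. Y $ j $ j \<noteq> 0} < card {j. X $ j $ j \<noteq> 0}"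
      by (intro psubset_card_mono) auto
    then have "0 \<le> M \<bullet> Y"
      using less.hyps \<open>psd Y\<close> by blast
    moreover have "0 \<le> M \<bullet> outer w"
      using assms(1) by (simp add: psd_iff_inner_outer)
    moreover have "M \<bullet> X = M \<bullet> Y + (M \<bullet> outer w) / X $ i $ i"
      by (simp add: Y_def inner_diff_right)
    ultimately show ?thesis
      using pos by simp
  qed
qed

lemma psd_congruence:
  assumes "psd X"
  shows "psd (B ** X ** transpose B)"
proof -
  have "v \<bullet> ((B ** X ** transpose B) *v v) = (transpose B *v v) \<bullet> (X *v (transpose B *v v))" for v
    by (metis matrix_vector_mul_assoc dot_lmul_matrix transpose_matrix_vector)
  then show ?thesis
    using assms
    by (simp add: psd_def sym_mat_def matrix_transpose_mul matrix_mul_assoc del: transpose_matrix_vector)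
qed

lemma outer_scaleR: "outer (c *\<^sub>R v) = c\<^sup>2 *\<^sub>R outer v"
  by (simp add: outer_def vec_eq_iff power2_eq_square)

lemma continuous_on_outer [continuous_intros]:
  "continuous_on S f \<Longrightarrow> continuous_on S (\<lambda>x. outer (f x))"
  unfolding outer_def by (intro continuous_intros)

text \<open>Quadratic forms are homogeneous. Restricting to the unit sphere makes the directions
  range over a compact set, so that a first time of failure exists.\<close>

lemma psd_if_unit_vectors:
  assumes "transpose M = M" "\<And>v. norm v = 1 \<Longrightarrow> 0 \<le> M \<bullet> outer v"
  shows "psd M"
  unfolding psd_iff_inner_outer
proof (intro conjI allI)
  fix v
  show "0 \<le> M \<bullet> outer v"
  proof (cases "v = 0")
    case False
    then have "0 \<le> M \<bullet> outer ((1 / norm v) *\<^sub>R v)"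
      by (intro assms(2)) simp
    with False show ?thesis
      by (simp add: outer_scaleR zero_le_mult_iff)
  qed (simp add: inner_outer)
qed fact

lemma psd_sum:
  assumes "\<And>i. i \<in> I \<Longrightarrow> psd (f i)"
  shows "psd (sum f I)"
  using assms
proof (induction I rule: infinite_finite_induct)
  case (insert i I)
  then show ?case by (simp add: psd_add)
qed (simp_all add: psd_def sym_mat_def transpose_def vec_eq_iff)

text \<open>Equivalence of norms in finite dimension: expansion in the basis gives the upper bound
  and hence Lipschitz continuity of \<open>\<nu>\<close>; its minimum on the Frobenius unit sphere
  gives the lower bound. All other estimates can then use the Frobenius norm.\<close>

lemma matrix_norm_bounds:
  assumes "matrix_norm \<nu>"
  obtains c where "c > 0" "\<And>M. \<nu> M \<le> c * norm M" "\<And>M. norm M \<le> c * \<nu> M"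
proof -
  have nn: "0 \<le> \<nu> M" and zero: "\<nu> M = 0 \<longleftrightarrow> M = 0"
    and scale: "\<nu> (r *\<^sub>R M) = \<bar>r\<bar> * \<nu> M" and tri: "\<nu> (M + K) \<le> \<nu> M + \<nu> K" for M K r
    using assms by (simp_all add: matrix_norm_def)
  define a where "a = (\<Sum>b\<in>Basis. \<nu> b)"
  have upper: "\<nu> M \<le> a * norm M" for M
  proof -
    have sum: "\<nu> (\<Sum>b\<in>F. f b) \<le> (\<Sum>b\<in>F. \<nu> (f b))" if "finite F"
      for F and f :: "real ^ 'a ^ 'a \<Rightarrow> real ^ 'a ^ 'a"
      using that
    proof (induction F)
      case (insert b F)
      then show ?case using tri[of "f b" "sum f F"] by simp
    qed (use zero[of 0] in simp)
    have "\<nu> M = \<nu> (\<Sum>b\<in>Basis. (M \<bullet> b) *\<^sub>R b)"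
      by (simp add: euclidean_representation)
    also have "\<dots> \<le> (\<Sum>b\<in>Basis. \<bar>M \<bullet> b\<bar> * \<nu> b)"
      using sum[of Basis "\<lambda>b. (M \<bullet> b) *\<^sub>R b"] by (simp add: scale)
    also have "\<dots> \<le> (\<Sum>b\<in>Basis. norm M * \<nu> b)"
      by (intro sum_mono mult_right_mono Basis_le_norm nn)
    finally show ?thesis
      by (simp add: a_def sum_distrib_left mult.commute)
  qed
  have "a \<ge> 0"
    by (simp add: a_def sum_nonneg nn)
  have "\<bar>\<nu> M - \<nu> K\<bar> \<le> a * norm (M - K)" for M K
    using tri[of "M - K" K] tri[of "K - M" M] upper[of "M - K"] upper[of "K - M"]
    by (simp add: norm_minus_commute)
  then have "a-lipschitz_on UNIV \<nu>"
    using \<open>a \<ge> 0\<close> by (auto simp: lipschitz_on_def dist_norm)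
  then have "continuous_on (sphere 0 1) \<nu>"
    by (metis lipschitz_on_continuous_on continuous_on_subset top_greatest)
  moreover have "sphere 0 1 \<noteq> ({} :: (real ^ 'a ^ 'a) set)"
    by simp
  ultimately obtain S where S: "S \<in> sphere 0 1" "\<And>M. M \<in> sphere 0 1 \<Longrightarrow> \<nu> S \<le> \<nu> M"
    using continuous_attains_inf[OF compact_sphere] by blast
  have "S \<noteq> 0" using S(1) by auto
  then have "\<nu> S > 0"
    using nn[of S] zero[of S] by simp
  have lower: "norm M \<le> (1 / \<nu> S) * \<nu> M" for M
  proof (cases "M = 0")
    case False
    then have "\<nu> S \<le> \<nu> ((1 / norm M) *\<^sub>R M)"
      by (intro S) simp
    then show ?thesis
      using False \<open>\<nu> S > 0\<close> by (simp add: scale field_simps)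
  qed (use nn \<open>\<nu> S > 0\<close> in simp)
  define c where "c = max (a + 1) (1 / \<nu> S)"
  have "\<nu> M \<le> c * norm M" for M
    by (rule order_trans[OF upper]) (auto intro!: mult_right_mono simp: c_def)
  moreover have "norm M \<le> c * \<nu> M" for M
    by (rule order_trans[OF lower]) (intro mult_right_mono nn, simp add: c_def)
  moreover have "c > 0"
    using \<open>a \<ge> 0\<close> by (simp add: c_def)
  ultimately show ?thesis using that by blast
qed

section \<open>Solutions of the matrix system\<close>

lemma linear_sys_op: "linear (sys_op A N \<mu> t)"
  by (rule linearI)
    (simp_all add: sys_op_def matrix_mult.add_left matrix_mult.add_right matrix_mult.scaleR_left
      matrix_mult.scaleR_right sum.distrib scaleR_sum_right scaleR_add_right add_ac mult.commute)

lemma adj_op_eq_sys_op: "adj_op A N \<mu> t P = sys_op (\<lambda>i t. transpose (A i t)) N \<mu> t P"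
  by (simp add: adj_op_def sys_op_def)

lemma linear_adj_op: "linear (adj_op A N \<mu> t)"
  using linear_sys_op by (simp add: adj_op_eq_sys_op[abs_def])

text \<open>Adjointness for the Frobenius inner product. By it the derivative of
  \<open>P t \<bullet> X t\<close> along a solution is the inner product of \<open>X t\<close> with
  the expression \<open>P' t + adj_op A N \<mu> t (P t)\<close> of the Lyapunov relations.\<close>

lemma inner_sys_op: "P \<bullet> sys_op A N \<mu> t X = adj_op A N \<mu> t P \<bullet> X"
proof -
  have r: "P \<bullet> (Y ** transpose B) = (P ** B) \<bullet> Y" for P Y B :: "real ^ 'a ^ 'a"
    by (simp add: inner_matrix_mult_right)
  have c: "P \<bullet> (B ** X ** transpose B) = (transpose B ** P ** B) \<bullet> X" for B
    by (simp only: r[of P "B ** X" B] inner_matrix_mult_left[of "P ** B" B X] matrix_mul_assoc)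
  show ?thesis
    by (simp add: sys_op_def adj_op_def inner_add_left inner_add_right inner_sum_left inner_sum_right
        c r[of P X "A 0 t"] inner_matrix_mult_left[of P "A 0 t" X])
qed

lemma transpose_sys_op: "transpose (sys_op A N \<mu> t X) = sys_op A N \<mu> t (transpose X)"
  by (simp add: sys_op_def transpose_add transpose_scalar matrix_transpose_mul matrix_mul_assoc
      linear_sum[OF linear_transpose] add_ac)

lemma continuous_sys_op:
  assumes "\<And>i. i \<le> N \<Longrightarrow> continuous F (A i)" "continuous F \<mu>" "continuous F X"
  shows "continuous F (\<lambda>s. sys_op A N \<mu> s (X s))"
  unfolding sys_op_def using assms
  by (auto intro!: continuous_intros matrix_mult.continuous
      bounded_linear.continuous[OF bounded_linear_transpose])

lemma continuous_sys_op_regular: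
  assumes "regular_time A N \<mu> t" "continuous (at t within {0..}) X"
  shows "continuous (at t within {0..}) (\<lambda>s. sys_op A N \<mu> s (X s))"
  using assms by (intro continuous_sys_op) (auto simp: regular_time_def)

lemma continuous_adj_op_regular:
  assumes "regular_time A N \<mu> t" "continuous (at t within {0..}) X"
  shows "continuous (at t within {0..}) (\<lambda>s. adj_op A N \<mu> s (X s))"
  unfolding adj_op_eq_sys_op using assms
  by (intro continuous_sys_op bounded_linear.continuous[OF bounded_linear_transpose])
    (auto simp: regular_time_def)

lemma solution_combination:
  assumes "solution A N \<mu> t0 X0 X" "solution A N \<mu> t0 Y0 Y"
  shows "solution A N \<mu> t0 (a *\<^sub>R X0 + b *\<^sub>R Y0) (\<lambda>t. a *\<^sub>R X t + b *\<^sub>R Y t)"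
  using assms unfolding solution_def
  by (auto intro!: continuous_intros derivative_eq_intros
      simp: linear_add[OF linear_sys_op] linear_scale[OF linear_sys_op])

lemma solution_transpose:
  assumes "solution A N \<mu> t0 X0 X"
  shows "solution A N \<mu> t0 (transpose X0) (\<lambda>t. transpose (X t))"
  using assms unfolding solution_def
  by (auto intro!: bounded_linear.continuous_on[OF bounded_linear_transpose]
      bounded_linear.has_vector_derivative[OF bounded_linear_transpose]
      simp flip: transpose_sys_op)

lemma solution_restart:
  assumes "solution A N \<mu> t0 X0 X" "t0 \<le> t1"
  shows "solution A N \<mu> t1 (X t1) X"
  unfolding solution_def
proof (intro conjI allI impI refl)
  show "continuous_on {t1..} X"
    using assms by (auto simp: solution_def intro: continuous_on_subset)
  fix t assume "t1 \<le> t" "regular_time A N \<mu> t"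
  then have "(X has_vector_derivative sys_op A N \<mu> t (X t)) (at t within {t0..})"
    using assms by (simp add: solution_def)
  then show "(X has_vector_derivative sys_op A N \<mu> t (X t)) (at t within {t1..})"
    by (rule has_vector_derivative_within_subset) (use assms in auto)
qed

lemma solution_has_vector_derivative_at:
  assumes "solution A N \<mu> t0 X0 X" "t0 < t" "regular_time A N \<mu> t"
  shows "(X has_vector_derivative sys_op A N \<mu> t (X t)) (at t)"
proof -
  have "(X has_vector_derivative sys_op A N \<mu> t (X t)) (at t within {t0..})"
    using assms by (simp add: solution_def)
  moreover have "at t within {t0..} = at t"
    using assms(2) by (intro at_within_interior) simp
  ultimately show ?thesis by simp
qed

section \<open>A priori estimates under bounded coefficients\<close>

locale bounded_coefficients =
  fixes A :: "nat \<Rightarrow> real \<Rightarrow> real ^ 'n ^ 'n" and N :: nat and \<mu> :: "real \<Rightarrow> real"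
  assumes A: "\<And>i. i \<le> N \<Longrightarrow> piecewise_continuous (A i) \<and> bounded (A i ` {0..})"
    and \<mu>: "piecewise_continuous \<mu>" "bounded (\<mu> ` {0..})"
begin

lemma finite_irregular: "finite {t \<in> {0..T}. \<not> regular_time A N \<mu> t}"
proof (rule finite_subset)
  show "{t \<in> {0..T}. \<not> regular_time A N \<mu> t} \<subseteq>
      (\<Union>i\<le>N. {t \<in> {0..T}. \<not> continuous (at t within {0..}) (A i)}) \<union>
      {t \<in> {0..T}. \<not> continuous (at t within {0..}) \<mu>}"
    by (auto simp: regular_time_def)
qed (use A \<mu> in \<open>auto simp: piecewise_continuous_def\<close>)

lemma coefficient_bounds:
  "\<exists>a>0. (\<forall>i\<le>N. \<forall>t\<ge>0. norm (A i t) \<le> a) \<and> (\<forall>t\<ge>0. \<bar>\<mu> t\<bar> \<le> a)"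
proof -
  have "bounded ((\<Union>i\<le>N. A i ` {0..}))"
    using A by (intro bounded_UN) auto
  then obtain a where a: "a > 0" "\<And>i t. i \<le> N \<Longrightarrow> 0 \<le> t \<Longrightarrow> norm (A i t) \<le> a"
    unfolding bounded_pos by fastforce
  obtain b where b: "\<And>t. 0 \<le> t \<Longrightarrow> \<bar>\<mu> t\<bar> \<le> b"
    using \<mu>(2) unfolding bounded_pos by fastforce
  show ?thesis
    by (rule exI[of _ "max a b"]) (use a b in \<open>auto simp: le_max_iff_disj\<close>)
qed

lemma sys_op_bound:
  obtains K where "K > 0" "\<And>t X. 0 \<le> t \<Longrightarrow> norm (sys_op A N \<mu> t X) \<le> K * norm X"
proof -
  obtain a where a: "a > 0" "\<And>i t. i \<le> N \<Longrightarrow> 0 \<le> t \<Longrightarrow> norm (A i t) \<le> a"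
    "\<And>t. 0 \<le> t \<Longrightarrow> \<bar>\<mu> t\<bar> \<le> a"
    using coefficient_bounds by blast
  obtain c where c: "c > 0"
    "\<And>(M :: real ^ 'n ^ 'n) (K :: real ^ 'n ^ 'n). norm (M ** K) \<le> norm M * norm K * c"
    using matrix_mult.pos_bounded by blast
  have c': "norm (M ** K) \<le> m * k * c" if "norm M \<le> m" "norm K \<le> k" for M K :: "real ^ 'n ^ 'n" and m k
    using that c(1) order_trans[OF norm_ge_zero that(1)]
    by (intro order_trans[OF c(2)] mult_right_mono mult_mono) auto
  \<comment> \<open>One summand for each kind of term in \<open>sys_op\<close>; every matrix product
    costs a factor \<open>c\<close>.\<close>
  define K where "K = 2 * a * c + N * (a * a * c * c) + a"
  have "norm (sys_op A N \<mu> t X) \<le> K * norm X" if t: "0 \<le> t" for t X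
  proof -
    have "norm (A 0 t ** X) \<le> a * norm X * c"
      using a t by (intro c') auto
    moreover have "norm (X ** transpose (A 0 t)) \<le> norm X * a * c"
      using a t by (intro c') (auto simp: norm_transpose)
    moreover have "norm (\<Sum>i=1..N. A i t ** X ** transpose (A i t)) \<le>
        (\<Sum>i=1..N. (a * norm X * c) * a * c)"
      using a t by (intro sum_norm_le c') (auto simp: norm_transpose)
    moreover have "norm (\<mu> t *\<^sub>R X) \<le> a * norm X"
      using a t by (simp add: mult_right_mono)
    ultimately have "norm (sys_op A N \<mu> t X) \<le>
        a * norm X * c + norm X * a * c + (\<Sum>i=1..N. (a * norm X * c) * a * c) + a * norm X"
      unfolding sys_op_def by (intro norm_triangle_le add_mono) auto
    also have "\<dots> = K * norm X"
      by (simp add: K_def algebra_simps)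
    finally show ?thesis .
  qed
  moreover have "K > 0"
    unfolding K_def using a(1) c(1) by (intro add_nonneg_pos add_nonneg_nonneg) auto
  ultimately show ?thesis using that by blast
qed

text \<open>A time-independent bound on the operator norm of \<open>sys_op\<close>, fixed once
  because it reappears as the exponential rate of solutions in both directions and in the bounds on
  \<open>P\<close>.\<close>

definition growth :: real where
  "growth = (SOME K. K > 0 \<and> (\<forall>t\<ge>0. \<forall>X. norm (sys_op A N \<mu> t X) \<le> K * norm X))"

lemma growth_pos: "growth > 0"
  and norm_sys_op_le: "0 \<le> t \<Longrightarrow> norm (sys_op A N \<mu> t X) \<le> growth * norm X"
proof -
  have "\<exists>K>0. \<forall>t\<ge>0. \<forall>X. norm (sys_op A N \<mu> t X) \<le> K * norm X"
    using sys_op_bound by metis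
  then have "growth > 0 \<and> (\<forall>t\<ge>0. \<forall>X. norm (sys_op A N \<mu> t X) \<le> growth * norm X)"
    unfolding growth_def by (rule someI_ex)
  then show "growth > 0" "0 \<le> t \<Longrightarrow> norm (sys_op A N \<mu> t X) \<le> growth * norm X"
    by auto
qed

text \<open>An adjoint inherits the norm bound: pair its image with itself and move the operator to
  the other side.\<close>

lemma norm_adj_op_le:
  assumes "0 \<le> t"
  shows "norm (adj_op A N \<mu> t P) \<le> growth * norm P"
proof (cases "adj_op A N \<mu> t P = 0")
  case False
  let ?Q = "adj_op A N \<mu> t P"
  have "norm ?Q * norm ?Q = P \<bullet> sys_op A N \<mu> t ?Q"
    by (simp add: inner_sys_op flip: power2_eq_square power2_norm_eq_inner)
  also have "\<dots> \<le> norm P * (growth * norm ?Q)"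
    by (intro order_trans[OF norm_cauchy_schwarz] mult_left_mono norm_sys_op_le assms) simp
  finally show ?thesis
    using False by (simp add: mult.assoc mult.commute[of "norm P"] flip: mult.assoc)
qed (use growth_pos in simp)

text \<open>The starting time 0 suffices: a solution with a prescribed value at a later time is a
  restart of one from time 0, because the flow is onto (\<open>flow_surj\<close>).\<close>

lemma solution_exists:
  obtains X where "solution A N \<mu> 0 X0 X"
proof (rule affine_ode_solution_exists[where L = "sys_op A N \<mu>" and R = "regular_time A N \<mu>"
      and K = growth and ?x0.0 = X0 and b = 0])
  show "continuous (at t within {0..}) (\<lambda>s. sys_op A N \<mu> s (x s))"
    if "continuous_on {0..} x" "0 \<le> t" "regular_time A N \<mu> t" for x t
    using that by (intro continuous_sys_op_regular) (auto simp: continuous_on_eq_continuous_within)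
  fix X assume "X 0 = X0" "continuous_on {0..} X"
    "\<And>t. 0 \<le> t \<Longrightarrow> regular_time A N \<mu> t \<Longrightarrow>
      (X has_vector_derivative (sys_op A N \<mu> t (X t) + 0)) (at t within {0..})"
  then show thesis
    by (intro that[of X]) (auto simp: solution_def)
qed (use linear_sys_op growth_pos norm_sys_op_le finite_irregular in auto)

text \<open>The derivative of the squared norm is at most \<open>2 * growth\<close> times the
  squared norm in absolute value. The upper estimate yields uniqueness; the lower one yields
  injectivity of the flow and the lower bound on \<open>P\<close>.\<close>

lemma solution_energy:
  assumes X: "solution A N \<mu> t0 X0 X" and "0 \<le> t0" "t0 \<le> t"
  shows "(norm (X t))\<^sup>2 \<le> exp (2 * growth * (t - t0)) * (norm X0)\<^sup>2"
    and "exp (- 2 * growth * (t - t0)) * (norm X0)\<^sup>2 \<le> (norm (X t))\<^sup>2"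
proof -
  define S where "S = {s \<in> {0..t}. \<not> regular_time A N \<mu> s}"
  define u where "u s = X s \<bullet> X s" for s
  have cont: "continuous_on {t0..t} u"
    unfolding u_def using X
    by (intro continuous_intros) (auto simp: solution_def intro: continuous_on_subset)
  have der: "(u has_real_derivative 2 * (X s \<bullet> sys_op A N \<mu> s (X s))) (at s)"
    and le: "\<bar>X s \<bullet> sys_op A N \<mu> s (X s)\<bar> \<le> growth * u s" if "s \<in> {t0<..<t} - S" for s
  proof -
    have s: "0 \<le> s" "t0 < s" "regular_time A N \<mu> s"
      using that assms(2) by (auto simp: S_def)
    have X': "(X has_vector_derivative sys_op A N \<mu> s (X s)) (at s)"
      by (rule solution_has_vector_derivative_at[OF X s(2,3)])
    show "(u has_real_derivative 2 * (X s \<bullet> sys_op A N \<mu> s (X s))) (at s)"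
      unfolding u_def using has_real_derivative_inner[OF X' X'] by (simp add: inner_commute)
    have "\<bar>X s \<bullet> sys_op A N \<mu> s (X s)\<bar> \<le> norm (X s) * (growth * norm (X s))"
      by (intro order_trans[OF Cauchy_Schwarz_ineq2] mult_left_mono norm_sys_op_le s) simp
    then show "\<bar>X s \<bullet> sys_op A N \<mu> s (X s)\<bar> \<le> growth * u s"
      by (simp add: u_def dot_square_norm power2_eq_square mult_ac)
  qed
  have fin: "finite S"
    unfolding S_def by (rule finite_irregular)
  have X_t0: "X t0 = X0"
    using X by (simp add: solution_def)
  have "exp (- 2 * growth * (t - t0)) * u t0 \<le> u t"
  proof (rule gronwall_off_finite[OF assms(3) fin cont])
    fix s assume s: "s \<in> {t0<..<t} - S"
    show "\<exists>D\<ge>- 2 * growth * u s. (u has_real_derivative D) (at s)"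
    proof (intro exI conjI)
      show "- 2 * growth * u s \<le> 2 * (X s \<bullet> sys_op A N \<mu> s (X s))"
        using le[OF s] by linarith
    qed (rule der[OF s])
  qed
  then show "exp (- 2 * growth * (t - t0)) * (norm X0)\<^sup>2 \<le> (norm (X t))\<^sup>2"
    by (simp add: u_def X_t0 power2_norm_eq_inner)
  have "exp (2 * growth * (t - t0)) * (- u t0) \<le> - u t"
  proof (rule gronwall_off_finite[OF assms(3) fin])
    show "continuous_on {t0..t} (\<lambda>s. - u s)"
      by (intro continuous_intros cont)
    fix s assume s: "s \<in> {t0<..<t} - S"
    show "\<exists>D\<ge>2 * growth * - u s. ((\<lambda>s. - u s) has_real_derivative D) (at s)"
    proof (intro exI conjI)
      show "2 * growth * - u s \<le> - (2 * (X s \<bullet> sys_op A N \<mu> s (X s)))"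
        using le[OF s] by linarith
    qed (rule DERIV_minus[OF der[OF s]])
  qed
  then show "(norm (X t))\<^sup>2 \<le> exp (2 * growth * (t - t0)) * (norm X0)\<^sup>2"
    by (simp add: u_def X_t0 power2_norm_eq_inner)
qed

lemma solution_unique:
  assumes "solution A N \<mu> t0 X0 X" "solution A N \<mu> t0 X0 Y" "0 \<le> t0" "t0 \<le> t"
  shows "X t = Y t"
proof -
  have "solution A N \<mu> t0 0 (\<lambda>t. X t - Y t)"
    using solution_combination[OF assms(1,2), of 1 "- 1"] by simp
  from solution_energy(1)[OF this assms(3,4)] show ?thesis by simp
qed

text \<open>The transpose of a solution is again a solution, with the same initial value, so
  uniqueness identifies the two.\<close>

lemma solution_symmetric:
  assumes "solution A N \<mu> t0 X0 X" "transpose X0 = X0" "0 \<le> t0" "t0 \<le> t"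
  shows "transpose (X t) = X t"
  using solution_unique[OF _ assms(1,3,4), of "\<lambda>t. transpose (X t)"]
    solution_transpose[OF assms(1)] assms(2) by simp

end

text \<open>Near a boundary point \<open>Z v = 0\<close> of the cone the only terms of \<open>sys_op\<close> without a
  sign are controlled by \<open>outer v ** Z\<close>, which vanishes there.\<close>

lemma sys_op_inner_outer_ge:
  assumes "psd Z" "norm (A 0 t) \<le> a" "\<bar>\<mu> t\<bar> \<le> a"
  shows "- (2 * a * norm (outer v ** Z) + a * \<bar>Z \<bullet> outer v\<bar>) \<le> sys_op A N \<mu> t Z \<bullet> outer v"
proof -
  have sym: "transpose Z = Z" "transpose (outer v) = outer v"
    using assms(1) psd_outer[of v] by (simp_all add: psd_iff_inner_outer)
  have e1: "(A 0 t ** Z) \<bullet> outer v = (outer v ** Z) \<bullet> A 0 t"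
    using inner_matrix_mult_right[of "outer v" "A 0 t" Z] sym by (simp add: inner_commute)
  have e2: "(Z ** transpose (A 0 t)) \<bullet> outer v = (outer v ** Z) \<bullet> A 0 t"
    using inner_transpose_transpose[of "A 0 t ** Z" "outer v"] sym e1
    by (simp add: matrix_transpose_mul)
  have "\<bar>(outer v ** Z) \<bullet> A 0 t\<bar> \<le> norm (outer v ** Z) * a"
    by (intro order_trans[OF Cauchy_Schwarz_ineq2] mult_left_mono assms) simp
  moreover have "\<bar>\<mu> t * (Z \<bullet> outer v)\<bar> \<le> a * \<bar>Z \<bullet> outer v\<bar>"
    by (simp add: abs_mult mult_right_mono assms)
  moreover have "psd (\<Sum>i=1..N. A i t ** Z ** transpose (A i t))"
    by (intro psd_sum psd_congruence assms)
  then have "0 \<le> (\<Sum>i=1..N. A i t ** Z ** transpose (A i t)) \<bullet> outer v"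
    by (simp only: psd_iff_inner_outer)
  moreover have "sys_op A N \<mu> t Z \<bullet> outer v = 2 * ((outer v ** Z) \<bullet> A 0 t) +
      (\<Sum>i=1..N. A i t ** Z ** transpose (A i t)) \<bullet> outer v + \<mu> t * (Z \<bullet> outer v)"
    unfolding sys_op_def inner_add_left e1 e2 by simp
  moreover have "2 * a * norm (outer v ** Z) = 2 * (norm (outer v ** Z) * a)"
    by simp
  ultimately show ?thesis
    by linarith
qed

section \<open>Invariance of the semidefinite cone\<close>

context bounded_coefficients
begin

text \<open>The perturbation \<open>\<epsilon> e\<^bsup>k(t - t\<^sub>0)\<^esup> I\<close> makes the vector field point strictly into the cone at
  the first time \<open>\<tau>\<close> at which positivity could fail. Only an interval to the left of \<open>\<tau>\<close> is used,
  so that \<open>\<tau>\<close> may be a jump of the coefficients.\<close>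

lemma solution_psd:
  assumes X: "solution A N \<mu> t0 X0 X" and "psd X0" "0 \<le> t0" "t0 \<le> t1"
  shows "psd (X t1)"
proof (rule psd_if_unit_vectors)
  have X_sym: "transpose (X t) = X t" if "t0 \<le> t" for t
    using solution_symmetric[OF X _ \<open>0 \<le> t0\<close> that] \<open>psd X0\<close> by (simp add: psd_iff_inner_outer)
  show "transpose (X t1) = X t1"
    using X_sym assms by simp
  obtain a where a: "a > 0" "\<And>i t. i \<le> N \<Longrightarrow> 0 \<le> t \<Longrightarrow> norm (A i t) \<le> a"
    "\<And>t. 0 \<le> t \<Longrightarrow> \<bar>\<mu> t\<bar> \<le> a"
    using coefficient_bounds by blast
  \<comment> \<open>\<open>k - 1\<close> bounds the form of
    \<open>sys_op A N \<mu> t (mat 1)\<close> on unit vectors; the surplus 1 leaves a margin of at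
    least \<epsilon> in the derivative of the perturbed form.\<close>
  define k where "k = growth * norm (mat 1 :: real ^ 'n ^ 'n) + 1"
  have "k \<ge> 0" using growth_pos by (simp add: k_def)
  have pos: "0 < X t1 \<bullet> outer w + \<epsilon> * exp (k * (t1 - t0))" if "\<epsilon> > 0" "norm w = 1" for \<epsilon> w
  proof (rule ccontr)
    define Z where "Z t = X t + (\<epsilon> * exp (k * (t - t0))) *\<^sub>R mat 1" for t
    have Z_outer: "Z t \<bullet> outer v = X t \<bullet> outer v + \<epsilon> * exp (k * (t - t0))" if "norm v = 1" for t v
      by (simp add: Z_def inner_add_left inner_mat_1_outer that)
    have Z_sym: "transpose (Z t) = Z t" if "t0 \<le> t" for t
      by (simp add: Z_def transpose_add transpose_scalar X_sym that)
    have X_cont: "continuous_on {t0..} X"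
      using X by (simp add: solution_def)
    then have Z_cont: "continuous_on {t0..} Z"
      unfolding Z_def by (intro continuous_intros)
    \<comment> \<open>The pairs of time and direction at which strict positivity fails. Compactness
      lets the first such time be attained.\<close>
    define B where "B = {p \<in> {t0..t1} \<times> sphere 0 1. Z (fst p) \<bullet> outer (snd p) \<le> 0}"
    assume "\<not> 0 < X t1 \<bullet> outer w + \<epsilon> * exp (k * (t1 - t0))"
    then have "(t1, w) \<in> B"
      using that assms by (simp add: B_def Z_outer)
    have "closed B"
      unfolding B_def
      by (intro continuous_on_closed_Collect_le continuous_intros
          continuous_on_compose2[OF Z_cont] closed_Times) auto
    moreover have "bounded B"
      by (rule bounded_subset[of "{t0..t1} \<times> sphere 0 1"]) (auto simp: B_def intro: bounded_Times)
    ultimately have "compact B"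
      by (simp add: compact_eq_bounded_closed)
    moreover have "B \<noteq> {}" "continuous_on B fst"
      using \<open>(t1, w) \<in> B\<close> by (auto intro: continuous_intros)
    ultimately obtain p where p: "p \<in> B" and p_min: "\<And>q. q \<in> B \<Longrightarrow> fst p \<le> fst q"
      using continuous_attains_inf[of B fst] by auto
    obtain \<tau> v where [simp]: "p = (\<tau>, v)" by (cases p)
    have \<tau>: "t0 \<le> \<tau>" "\<tau> \<le> t1" "norm v = 1" "Z \<tau> \<bullet> outer v \<le> 0"
      using p by (auto simp: B_def)
    have before: "0 < Z t \<bullet> outer u" if "t0 \<le> t" "t < \<tau>" "norm u = 1" for t u
      using p_min[of "(t, u)"] that \<tau> by (force simp: B_def)
    have "Z t0 \<bullet> outer v > 0"
    proof -
      have "0 \<le> X t0 \<bullet> outer v"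
        using X \<open>psd X0\<close> by (simp add: solution_def psd_iff_inner_outer)
      with \<open>\<epsilon> > 0\<close> show ?thesis by (simp add: Z_outer \<tau>)
    qed
    with \<tau> have "t0 < \<tau>" by (cases "\<tau> = t0") auto
    have Z_cont_\<tau>: "continuous_on {t0..\<tau>} Z"
      by (rule continuous_on_subset[OF Z_cont]) auto
    have psd_before: "psd (Z t)" if "t0 \<le> t" "t < \<tau>" for t
      using before that Z_sym by (intro psd_if_unit_vectors) (auto intro: less_imp_le)
    have "psd (Z \<tau>)"
    proof (rule psd_if_unit_vectors)
      fix u :: "real ^ 'n" assume "norm u = 1"
      show "0 \<le> Z \<tau> \<bullet> outer u"
      proof (rule continuous_ge_on_closure[where S = "{t0..<\<tau>}" and f = "\<lambda>t. Z t \<bullet> outer u"])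
        show "continuous_on (closure {t0..<\<tau>}) (\<lambda>t. Z t \<bullet> outer u)"
          using \<open>t0 < \<tau>\<close> by (auto intro!: continuous_intros Z_cont_\<tau>)
      qed (use \<open>t0 < \<tau>\<close> before \<open>norm u = 1\<close> in \<open>auto intro: less_imp_le\<close>)
    qed (use Z_sym \<tau> in simp)
    then have Z_v: "Z \<tau> \<bullet> outer v = 0" "Z \<tau> *v v = 0"
      using \<tau>(4) psd_kernel[of "Z \<tau>" v] by (auto simp: psd_iff_inner_outer inner_outer antisym)
    \<comment> \<open>The error term of \<open>sys_op_inner_outer_ge\<close>. It vanishes at \<tau>
      because \<open>outer v ** Z \<tau>\<close> is the product of \<open>v\<close> with the
      transpose of \<open>Z \<tau> *v v\<close>, so it is below \<epsilon> shortly before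
      \<tau>.\<close>
    define r where "r t = 2 * a * norm (outer v ** Z t) + a * \<bar>Z t \<bullet> outer v\<bar>" for t
    have "outer v ** Z \<tau> = 0"
    proof -
      have "(outer v ** Z \<tau>) $ i $ j = v $ i * (transpose (Z \<tau>) *v v) $ j" for i j
        by (simp add: outer_def matrix_matrix_mult_def matrix_vector_mult_def transpose_def
            sum_distrib_left mult_ac del: transpose_matrix_vector)
      then show ?thesis
        using Z_v Z_sym[of \<tau>] \<tau> by (simp add: vec_eq_iff del: transpose_matrix_vector)
    qed
    then have "r \<tau> = 0"
      by (simp add: r_def Z_v)
    have "continuous_on {t0..\<tau>} r"
      unfolding r_def
      by (intro continuous_intros matrix_mult.continuous_on Z_cont_\<tau>)
    then have "continuous (at \<tau> within {t0..\<tau>}) r"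
      using \<open>t0 < \<tau>\<close> by (simp add: continuous_on_eq_continuous_within)
    then obtain d where d: "d > 0"
      "\<And>t. t \<in> {t0..\<tau>} \<Longrightarrow> dist t \<tau> < d \<Longrightarrow> dist (r t) (r \<tau>) < \<epsilon>"
      using \<open>\<epsilon> > 0\<close> unfolding continuous_within_eps_delta by blast
    define s where "s = max t0 (\<tau> - d / 2)"
    have s: "t0 \<le> s" "s < \<tau>" "\<tau> - s < d"
      using \<open>t0 < \<tau>\<close> d(1) by (auto simp: s_def)
    \<comment> \<open>This is the contradiction: the form is positive at \<open>s\<close> and zero
      at \<tau>.\<close>
    have "Z s \<bullet> outer v \<le> Z \<tau> \<bullet> outer v"
    proof (rule nondecreasing_off_finite[where f = "\<lambda>t. Z t \<bullet> outer v", OF _ finite_irregular[of \<tau>]])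
      show "continuous_on {s..\<tau>} (\<lambda>t. Z t \<bullet> outer v)"
        using s by (intro continuous_intros continuous_on_subset[OF Z_cont_\<tau>]) auto
      fix t assume "t \<in> {s<..<\<tau>} - {t \<in> {0..\<tau>}. \<not> regular_time A N \<mu> t}"
      then have t: "s < t" "t < \<tau>" "regular_time A N \<mu> t" "0 \<le> t" "t0 < t"
        using s \<open>0 \<le> t0\<close> by auto
      let ?e = "\<epsilon> * exp (k * (t - t0))"
      have "\<epsilon> \<le> ?e"
        using \<open>\<epsilon> > 0\<close> \<open>k \<ge> 0\<close> t by simp
      have "(X has_vector_derivative sys_op A N \<mu> t (X t)) (at t)"
        by (rule solution_has_vector_derivative_at[OF X t(5,3)])
      then have "((\<lambda>t. X t \<bullet> outer v) has_vector_derivative sys_op A N \<mu> t (X t) \<bullet> outer v) (at t)"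
        by (rule bounded_linear.has_vector_derivative[OF bounded_linear_inner_left])
      then have der: "((\<lambda>t. Z t \<bullet> outer v) has_real_derivative
          sys_op A N \<mu> t (X t) \<bullet> outer v + k * ?e) (at t)"
        unfolding Z_outer[OF \<tau>(3)] has_real_derivative_iff_has_vector_derivative[symmetric]
        by (auto intro!: derivative_eq_intros)
      have "\<bar>sys_op A N \<mu> t (mat 1) \<bullet> outer v\<bar> \<le> k - 1"
        using order_trans[OF Cauchy_Schwarz_ineq2 mult_right_mono[OF norm_sys_op_le[OF t(4)]],
            of "outer v" "mat 1"] \<tau>(3)
        by (simp add: k_def norm_outer)
      then have "?e * (sys_op A N \<mu> t (mat 1) \<bullet> outer v) \<le> ?e * (k - 1)"
        using \<open>\<epsilon> > 0\<close> by (intro mult_left_mono) auto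
      moreover have "sys_op A N \<mu> t (Z t) \<bullet> outer v =
          sys_op A N \<mu> t (X t) \<bullet> outer v + ?e * (sys_op A N \<mu> t (mat 1) \<bullet> outer v)"
        by (simp add: Z_def linear_add[OF linear_sys_op] linear_scale[OF linear_sys_op] inner_add_left)
      moreover have "- r t \<le> sys_op A N \<mu> t (Z t) \<bullet> outer v"
        unfolding r_def using a t psd_before[of t] by (intro sys_op_inner_outer_ge) auto
      moreover have "r t < \<epsilon>"
        using d(2)[of t] s t \<open>r \<tau> = 0\<close> by (simp add: dist_real_def)
      ultimately have "0 \<le> sys_op A N \<mu> t (X t) \<bullet> outer v + k * ?e"
        using \<open>\<epsilon> \<le> ?e\<close> by (simp add: algebra_simps)
      with der show "\<exists>D\<ge>0. ((\<lambda>t. Z t \<bullet> outer v) has_real_derivative D) (at t)"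
        by blast
    qed (use s in simp)
    with before[OF s(1,2) \<tau>(3)] Z_v show False by simp
  qed
  fix w :: "real ^ 'n" assume w: "norm w = 1"
  show "0 \<le> X t1 \<bullet> outer w"
  proof (rule field_le_epsilon)
    fix e :: real assume "e > 0"
    then show "0 \<le> X t1 \<bullet> outer w + e"
      using pos[OF _ w, of "e / exp (k * (t1 - t0))"] by simp
  qed
qed

end

section \<open>Lyapunov equation and inequality\<close>

lemma equation_imp_inequality:
  assumes "lyapunov_equation_cond A N \<mu>"
  shows "lyapunov_inequality_cond A N \<mu>"
proof -
  obtain P P' Q \<alpha>1 \<alpha>2 \<beta>1 where pos: "\<alpha>1 > 0" "\<alpha>2 > 0" "\<beta>1 > 0"
    and P: "differentiable_with A N \<mu> P P'"
    and bounds: "\<And>t. t \<ge> 0 \<Longrightarrow> pd (P t) \<and> \<alpha>1 *\<^sub>R mat 1 \<preceq>\<^sub>L P t \<and> P t \<preceq>\<^sub>L \<alpha>2 *\<^sub>R mat 1"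
    and Q: "\<And>t. t \<ge> 0 \<Longrightarrow> \<beta>1 *\<^sub>R mat 1 \<preceq>\<^sub>L Q t"
    and eq: "\<And>t. t \<ge> 0 \<Longrightarrow> regular_time A N \<mu> t \<Longrightarrow> P' t + adj_op A N \<mu> t (P t) + Q t = 0"
    using assms unfolding lyapunov_equation_cond_def by blast
  have "P' t + adj_op A N \<mu> t (P t) \<preceq>\<^sub>L (- \<beta>1) *\<^sub>R mat 1"
    if "t \<ge> 0" "regular_time A N \<mu> t" for t
  proof -
    have "P' t + adj_op A N \<mu> t (P t) = - Q t"
      using eq[OF that] by (simp add: add_eq_0_iff2)
    then show ?thesis
      using Q[OF that(1)] by (simp add: loewner_le_def)
  qed
  with pos P bounds show ?thesis
    unfolding lyapunov_inequality_cond_def by blast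
qed

context bounded_coefficients
begin

lemma inequality_imp_stable:
  assumes "matrix_norm \<nu>" "lyapunov_inequality_cond A N \<mu>"
  shows "uniformly_exponentially_stable \<nu> A N \<mu>"
proof -
  obtain P P' \<alpha>1 \<alpha>2 \<alpha>3 where pos: "\<alpha>1 > 0" "\<alpha>2 > 0" "\<alpha>3 > 0"
    and P: "differentiable_with A N \<mu> P P'"
    and bounds: "\<And>t. t \<ge> 0 \<Longrightarrow> \<alpha>1 *\<^sub>R mat 1 \<preceq>\<^sub>L P t \<and> P t \<preceq>\<^sub>L \<alpha>2 *\<^sub>R mat 1"
    and ineq: "\<And>t. t \<ge> 0 \<Longrightarrow> regular_time A N \<mu> t \<Longrightarrow>
        P' t + adj_op A N \<mu> t (P t) \<preceq>\<^sub>L (- \<alpha>3) *\<^sub>R mat 1"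
    using assms(2) unfolding lyapunov_inequality_cond_def by blast
  obtain c where c: "c > 0" "\<And>M. \<nu> M \<le> c * norm M" "\<And>M. norm M \<le> c * \<nu> M"
    using matrix_norm_bounds[OF assms(1)] by blast
  define \<gamma> where "\<gamma> = \<alpha>3 / \<alpha>2"
  have "\<gamma> > 0" using pos by (simp add: \<gamma>_def)
  \<comment> \<open>The two factors \<open>c\<close> convert between \<open>\<nu>\<close> and the
    Frobenius norm at both ends, \<open>\<alpha>2 / \<alpha>1\<close> compares \<open>V\<close> with
    the trace, and the norm of the identity bounds the initial trace.\<close>
  define C where "C = c * (\<alpha>2 / \<alpha>1) * norm (mat 1 :: real ^ 'n ^ 'n) * c"
  have "C \<ge> 0" using pos c(1) by (simp add: C_def)
  have "\<nu> (X t) \<le> C * exp (- \<gamma> * (t - t0)) * \<nu> X0"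
    if t0: "0 \<le> t0" and "psd X0" and X: "solution A N \<mu> t0 X0 X" and t: "t0 \<le> t" for t0 X0 X t
  proof -
    define V where "V s = P s \<bullet> X s" for s
    have psd: "psd (X s)" if "t0 \<le> s" for s
      using solution_psd[OF X \<open>psd X0\<close> t0 that] .
    have V_bounds: "\<alpha>1 * (mat 1 \<bullet> X s) \<le> V s" "V s \<le> \<alpha>2 * (mat 1 \<bullet> X s)" if "t0 \<le> s" for s
      using bounds[of s] psd_inner_nonneg[OF _ psd[OF that]] that t0
      by (force simp: loewner_le_def V_def inner_diff_left)+
    have "exp (- \<gamma> * (t - t0)) * - V t0 \<le> - V t"
    proof (rule gronwall_off_finite[where u = "\<lambda>s. - V s", OF t finite_irregular[of t]])
      show "continuous_on {t0..t} (\<lambda>s. - V s)"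
        unfolding V_def using P X t0
        by (intro continuous_intros)
          (auto simp: differentiable_with_def solution_def intro: continuous_on_subset)
      fix s assume "s \<in> {t0<..<t} - {s \<in> {0..t}. \<not> regular_time A N \<mu> s}"
      then have s: "t0 < s" "regular_time A N \<mu> s" "0 < s"
        using t0 by auto
      have "(P has_vector_derivative P' s) (at s)"
        using P s by (intro has_vector_derivative_at_if_within_Ici[where a = 0])
          (auto simp: differentiable_with_def)
      from has_real_derivative_inner[OF this solution_has_vector_derivative_at[OF X s(1,2)]]
      have "(V has_real_derivative (P' s + adj_op A N \<mu> s (P s)) \<bullet> X s) (at s)"
        by (simp add: V_def[abs_def] inner_sys_op inner_add_left add.commute)
      then have "((\<lambda>s. - V s) has_real_derivative - ((P' s + adj_op A N \<mu> s (P s)) \<bullet> X s)) (at s)"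
        by (rule DERIV_minus)
      moreover have "(P' s + adj_op A N \<mu> s (P s)) \<bullet> X s \<le> - \<alpha>3 * (mat 1 \<bullet> X s)"
        using psd_inner_nonneg[OF ineq[unfolded loewner_le_def] psd[of s]] s
        by (simp add: inner_diff_left)
      moreover have "\<gamma> * V s \<le> \<alpha>3 * (mat 1 \<bullet> X s)"
        using V_bounds(2)[of s] s pos by (simp add: \<gamma>_def field_simps)
      ultimately show "\<exists>D\<ge>- \<gamma> * - V s. ((\<lambda>s. - V s) has_real_derivative D) (at s)"
        by (intro exI[of _ "- ((P' s + adj_op A N \<mu> s (P s)) \<bullet> X s)"]) simp
    qed
    then have V_decay: "V t \<le> exp (- \<gamma> * (t - t0)) * V t0"
      by simp
    have "norm (X t) \<le> mat 1 \<bullet> X t"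
      by (rule psd_norm_le_trace[OF psd[OF t]])
    also have "\<dots> \<le> V t / \<alpha>1"
      using V_bounds(1)[OF t] pos by (simp add: field_simps)
    also have "\<dots> \<le> exp (- \<gamma> * (t - t0)) * (\<alpha>2 * (mat 1 \<bullet> X0)) / \<alpha>1"
      using V_bounds(2)[of t0] X pos
      by (intro divide_right_mono order_trans[OF V_decay] mult_left_mono) (auto simp: solution_def)
    also have "\<dots> \<le> exp (- \<gamma> * (t - t0)) * (\<alpha>2 * (norm (mat 1 :: real ^ 'n ^ 'n) * norm X0)) / \<alpha>1"
      using pos by (intro divide_right_mono mult_left_mono norm_cauchy_schwarz) auto
    also have "\<dots> \<le> exp (- \<gamma> * (t - t0)) * (\<alpha>2 * (norm (mat 1 :: real ^ 'n ^ 'n) * (c * \<nu> X0))) / \<alpha>1"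
      using pos by (intro divide_right_mono mult_left_mono c) auto
    finally have "c * norm (X t) \<le>
        c * (exp (- \<gamma> * (t - t0)) * (\<alpha>2 * (norm (mat 1 :: real ^ 'n ^ 'n) * (c * \<nu> X0))) / \<alpha>1)"
      using c(1) by (intro mult_left_mono) auto
    with c(2)[of "X t"] show ?thesis
      by (simp add: C_def mult_ac)
  qed
  \<comment> \<open>The definition of stability asks for a factor of at least 1, hence
    \<open>max 1 C\<close>.\<close>
  moreover have "C * e * \<nu> X0 \<le> max 1 C * e * \<nu> X0" if "e \<ge> 0" for e X0
    using that assms(1) by (intro mult_right_mono) (auto simp: matrix_norm_def)
  ultimately have "\<nu> (X t) \<le> max 1 C * exp (- \<gamma> * (t - t0)) * \<nu> X0"
    if "0 \<le> t0" "psd X0" "solution A N \<mu> t0 X0 X" "t0 \<le> t" for t0 X0 X t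
    using that by (meson exp_ge_zero order_trans)
  then show ?thesis
    unfolding uniformly_exponentially_stable_def using \<open>\<gamma> > 0\<close> max.cobounded1 by blast
qed

text \<open>The choice is harmless for times at least 0, where solutions are unique. Labelling
  solutions by their value at time 0 avoids a two-parameter transition operator.\<close>

definition flow :: "real ^ 'n ^ 'n \<Rightarrow> real \<Rightarrow> real ^ 'n ^ 'n" where
  "flow Y = (SOME X. solution A N \<mu> 0 Y X)"

lemma flow_solution: "solution A N \<mu> 0 Y (flow Y)"
proof -
  obtain X where "solution A N \<mu> 0 Y X"
    by (rule solution_exists)
  then show ?thesis
    unfolding flow_def by (rule someI[where P = "solution A N \<mu> 0 Y"])
qed

lemma flow_eqI: "solution A N \<mu> 0 Y X \<Longrightarrow> 0 \<le> t \<Longrightarrow> flow Y t = X t"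
  using solution_unique[OF flow_solution] by simp

lemma flow_0: "flow Y 0 = Y"
  using flow_solution by (simp add: solution_def)

lemma linear_flow:
  assumes "0 \<le> t"
  shows "linear (\<lambda>Y. flow Y t)"
proof (rule linearI)
  show "flow (Y + Z) t = flow Y t + flow Z t" for Y Z
    using flow_eqI[OF _ assms] solution_combination[OF flow_solution flow_solution, of 1 Y 1 Z] by simp
  show "flow (r *\<^sub>R Y) t = r *\<^sub>R flow Y t" for r Y
    using flow_eqI[OF _ assms] solution_combination[OF flow_solution flow_solution, of r Y 0 Y] by simp
qed

lemma flow_transpose: "0 \<le> t \<Longrightarrow> flow (transpose Y) t = transpose (flow Y t)"
  by (rule flow_eqI[OF solution_transpose[OF flow_solution]])

lemma solution_flow_restart: "0 \<le> t \<Longrightarrow> solution A N \<mu> t (flow Y t) (flow Y)"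
  by (rule solution_restart[OF flow_solution])

text \<open>By the lower energy estimate no nonzero initial value is carried to 0; an injective
  linear map of a finite-dimensional space to itself is onto. No equation has to be solved backwards
  in time.\<close>

lemma flow_surj:
  assumes "0 \<le> t"
  obtains Y where "flow Y t = X0"
proof -
  have "Y = 0" if "flow Y t = 0" for Y
    using solution_energy(2)[OF flow_solution[of Y] _ assms] that
    by (simp add: mult_le_0_iff not_le[symmetric])
  then have "inj (\<lambda>Y. flow Y t)"
    using linear_injective_0[OF linear_flow[OF assms]] by blast
  then have "surj (\<lambda>Y. flow Y t)"
    by (rule linear_injective_imp_surjective[OF linear_flow[OF assms]]) (rule refl)
  then show ?thesis using that by (metis surjD)
qed

text \<open>Since the flow is onto at every time, the requirement
  \<open>P t \<bullet> flow Y t = \<integral>\<^bsub>t\<^esub>\<^bsup>\<infinity>\<^esup> trace (flow Y s) ds\<close> determines \<open>P\<close>. Riesz representation at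
  \<open>t = 0\<close> provides the initial value, and the Lyapunov equation with \<open>Q = I\<close> propagates it.\<close>

lemma stable_imp_equation:
  assumes "matrix_norm \<nu>" "uniformly_exponentially_stable \<nu> A N \<mu>"
  shows "lyapunov_equation_cond A N \<mu>"
proof -
  let ?I = "mat 1 :: real ^ 'n ^ 'n"
  obtain c where c: "c > 0" "\<And>M. \<nu> M \<le> c * norm M" "\<And>M. norm M \<le> c * \<nu> M"
    using matrix_norm_bounds[OF assms(1)] by blast
  obtain \<alpha> \<beta> where "\<alpha> > 0" "\<beta> \<ge> 1" and stable: "\<And>t0 X0 X t. t0 \<ge> 0 \<Longrightarrow> psd X0 \<Longrightarrow>
      solution A N \<mu> t0 X0 X \<Longrightarrow> t \<ge> t0 \<Longrightarrow> \<nu> (X t) \<le> \<beta> * exp (- \<alpha> * (t - t0)) * \<nu> X0"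
    using assms(2) unfolding uniformly_exponentially_stable_def by blast
  have "?I \<noteq> 0"
    by (auto simp: mat_def vec_eq_iff)
  \<comment> \<open>The norm of the identity comes from Cauchy-Schwarz for the trace, the two
    factors \<open>c\<close> from changing norms at both ends.\<close>
  define C where "C = norm ?I * c * \<beta> * c"
  have "C > 0"
    using \<open>?I \<noteq> 0\<close> c(1) \<open>\<beta> \<ge> 1\<close> by (simp add: C_def)
  have decay: "\<bar>?I \<bullet> X t\<bar> \<le> C * norm X0 * exp (- \<alpha> * (t - t0))"
    if "t0 \<ge> 0" "psd X0" "solution A N \<mu> t0 X0 X" "t \<ge> t0" for t0 X0 X t
  proof -
    have "\<bar>?I \<bullet> X t\<bar> \<le> norm ?I * norm (X t)"
      by (rule Cauchy_Schwarz_ineq2)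
    also have "\<dots> \<le> norm ?I * (c * (\<beta> * exp (- \<alpha> * (t - t0)) * (c * norm X0)))"
      using c \<open>\<beta> \<ge> 1\<close>
      by (intro mult_left_mono order_trans[OF c(3)] order_trans[OF stable[OF that]]) auto
    finally show ?thesis by (simp add: C_def mult_ac)
  qed
  define tr where "tr Y s = ?I \<bullet> flow Y s" for Y s
  have tr_cont: "continuous_on {0..} (tr Y)" for Y
    unfolding tr_def using flow_solution[of Y] by (auto intro!: continuous_intros simp: solution_def)
  have tr_lin: "linear (\<lambda>Y. tr Y s)" if "0 \<le> s" for s
    unfolding tr_def
    by (rule linear_compose[OF linear_flow[OF that] bounded_linear.linear[OF bounded_linear_inner_right],
          unfolded o_def])
  have tr_transpose: "tr (transpose Y) s = tr Y s" if "0 \<le> s" for Y s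
    using inner_transpose_transpose[of ?I "flow Y s"] that by (simp add: tr_def flow_transpose)
  have tr_int_psd: "tr Y integrable_on {t..}" if "0 \<le> t" "psd Y" for t Y
  proof (rule measurable_bounded_by_integrable_imp_integrable)
    show "tr Y \<in> borel_measurable (lebesgue_on {t..})"
      using that
      by (intro continuous_imp_measurable_on_sets_lebesgue continuous_on_subset[OF tr_cont]) auto
    show "(\<lambda>s. C * norm Y * exp (- \<alpha> * (s - 0))) integrable_on {t..}"
      using integrable_on_exp_minus_to_infinity[OF \<open>\<alpha> > 0\<close>, of t]
      by (auto intro!: integrable_on_mult_right)
    show "norm (tr Y s) \<le> C * norm Y * exp (- \<alpha> * (s - 0))" if "s \<in> {t..}" for s
      using decay[OF _ \<open>psd Y\<close> flow_solution, of s] that \<open>0 \<le> t\<close> by (simp add: tr_def)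
  qed simp
  \<comment> \<open>Stability controls semidefinite initial values only. The trace along the flow
    does not see the antisymmetric part of \<open>Y\<close>, and the symmetric part \<open>S\<close>
    is semidefinite up to a multiple of the identity, which is itself semidefinite.\<close>
  have tr_int: "tr Y integrable_on {t..}" if "0 \<le> t" for t Y
  proof -
    define S where "S = (1 / 2) *\<^sub>R (Y + transpose Y)"
    have "transpose S = S"
      by (simp add: S_def transpose_scalar transpose_add add.commute)
    then have psd: "psd (S + norm S *\<^sub>R mat 1)"
      by (rule sym_imp_psd_shift) simp
    have eq: "tr (S + norm S *\<^sub>R mat 1) s - norm S * tr (mat 1) s = tr Y s" if "0 \<le> s" for s
      using tr_transpose[OF that, of Y]
      by (simp add: S_def linear_add[OF tr_lin[OF that]] linear_scale[OF tr_lin[OF that]] field_simps)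
    have "(\<lambda>s. tr (S + norm S *\<^sub>R mat 1) s - norm S * tr (mat 1) s) integrable_on {t..}"
      by (intro integrable_diff integrable_on_mult_right tr_int_psd psd psd_mat_1 that)
    then show ?thesis
      by (rule integrable_eq) (use eq that in auto)
  qed
  define \<phi> where "\<phi> Y = integral {0..} (tr Y)" for Y
  have "linear \<phi>"
  proof (rule linearI)
    fix Y Z r
    have "\<phi> (Y + Z) = integral {0..} (\<lambda>s. tr Y s + tr Z s)"
      unfolding \<phi>_def by (rule integral_cong) (simp add: linear_add[OF tr_lin])
    then show "\<phi> (Y + Z) = \<phi> Y + \<phi> Z"
      by (simp add: \<phi>_def integral_add tr_int)
    have "\<phi> (r *\<^sub>R Y) = integral {0..} (\<lambda>s. r *\<^sub>R tr Y s)"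
      unfolding \<phi>_def by (rule integral_cong) (simp add: linear_scale[OF tr_lin])
    then show "\<phi> (r *\<^sub>R Y) = r *\<^sub>R \<phi> Y"
      by (simp add: \<phi>_def)
  qed
  \<comment> \<open>For a real-valued linear map the adjoint at 1 is the representing
    matrix.\<close>
  define P0 where "P0 = adjoint \<phi> 1"
  have P0: "P0 \<bullet> Y = \<phi> Y" for Y
    using adjoint_works[OF \<open>linear \<phi>\<close>, of Y 1] by (simp add: P0_def inner_commute)
  obtain P where P: "P 0 = P0" "continuous_on {0..} P"
    and P': "\<And>t. 0 \<le> t \<Longrightarrow> regular_time A N \<mu> t \<Longrightarrow>
      (P has_vector_derivative (- adj_op A N \<mu> t (P t) + - ?I)) (at t within {0..})"
  proof (rule affine_ode_solution_exists[where L = "\<lambda>t X. - adj_op A N \<mu> t X" and K = growth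
        and R = "regular_time A N \<mu>" and ?x0.0 = P0 and b = "- ?I"])
    show "continuous (at t within {0..}) (\<lambda>s. - adj_op A N \<mu> s (x s))"
      if "continuous_on {0..} x" "0 \<le> t" "regular_time A N \<mu> t" for x t
      using that
      by (intro continuous_minus continuous_adj_op_regular) (auto simp: continuous_on_eq_continuous_within)
    show "linear (\<lambda>X. - adj_op A N \<mu> t X)" for t
      by (rule linear_compose_neg[OF linear_adj_op])
  qed (use growth_pos norm_adj_op_le finite_irregular in auto)
  \<comment> \<open>In the derivative of \<open>P s \<bullet> flow Y s\<close> the operator terms
    cancel by adjointness, leaving \<open>- tr Y s\<close>; integration removes exactly the part
    over \<open>{0..t}\<close> from the integral represented by \<open>P0\<close>.\<close>
  have P_flow: "P t \<bullet> flow Y t = integral {t..} (tr Y)" if t: "0 \<le> t" for t Y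
  proof -
    define f where "f s = P s \<bullet> flow Y s" for s
    have "((\<lambda>s. - tr Y s) has_integral (f t - f 0)) {0..t}"
    proof (rule fundamental_theorem_of_calculus_interior_strong[OF finite_irregular[of t] t])
      show "continuous_on {0..t} f"
        unfolding f_def using flow_solution[of Y]
        by (intro continuous_intros)
          (auto simp: solution_def intro: continuous_on_subset[OF P(2)] continuous_on_subset)
      fix s assume "s \<in> {0<..<t} - {s \<in> {0..t}. \<not> regular_time A N \<mu> s}"
      then have s: "0 < s" "regular_time A N \<mu> s" by auto
      have "(P has_vector_derivative (- adj_op A N \<mu> s (P s) + - ?I)) (at s)"
        using P' s by (intro has_vector_derivative_at_if_within_Ici[where a = 0]) auto
      from has_real_derivative_inner[OF this solution_has_vector_derivative_at[OF flow_solution s]]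
      show "(f has_vector_derivative - tr Y s) (at s)"
        by (simp add: f_def[abs_def] tr_def inner_sys_op inner_diff_left
            flip: has_real_derivative_iff_has_vector_derivative)
    qed
    then have "integral {0..t} (tr Y) = f 0 - f t"
      by (auto dest!: has_integral_neg integral_unique)
    moreover have "integral {0..} (tr Y) = integral {0..t} (tr Y) + integral {t..} (tr Y)"
    proof -
      have "tr Y integrable_on {0..t}"
        by (intro integrable_continuous_interval continuous_on_subset[OF tr_cont]) auto
      moreover have "{0..t} \<inter> {t..} = {t}" "{0..t} \<union> {t..} = {0..}"
        using t by auto
      ultimately show ?thesis
        using integral_Un[OF _ tr_int[OF t]] by fastforce
    qed
    ultimately show ?thesis
      using P0[of Y] by (simp add: f_def P flow_0 \<phi>_def)
  qed
  have P_sym: "transpose (P t) = P t" if t: "0 \<le> t" for t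
  proof -
    \<comment> \<open>Every \<open>X\<close> is a value of the flow at time \<open>t\<close>, so
      symmetry reduces to the invariance of the trace under transposition.\<close>
    have "(transpose (P t) - P t) \<bullet> X = 0" for X
    proof -
      obtain Y where Y: "flow Y t = X"
        using flow_surj[OF t] .
      have "transpose (P t) \<bullet> X = P t \<bullet> transpose X"
        using inner_transpose_transpose[of "P t" "transpose X"] by simp
      also have "\<dots> = integral {t..} (tr (transpose Y))"
        using P_flow[OF t, of "transpose Y"] t by (simp add: flow_transpose Y)
      also have "\<dots> = integral {t..} (tr Y)"
        by (rule integral_cong) (use t tr_transpose in auto)
      also have "\<dots> = P t \<bullet> X"
        using P_flow[OF t, of Y] by (simp add: Y)
      finally show ?thesis by (simp add: inner_diff_left)
    qed
    from this[of "transpose (P t) - P t"] show ?thesis by simp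
  qed
  have P_bounds: "1 / growth * (norm v)\<^sup>2 \<le> P t \<bullet> outer v \<and> P t \<bullet> outer v \<le> C / \<alpha> * (norm v)\<^sup>2"
    if t: "0 \<le> t" for t v
  proof -
    obtain Y where Y: "flow Y t = outer v"
      using flow_surj[OF t] .
    have sol: "solution A N \<mu> t (outer v) (flow Y)"
      using solution_flow_restart[OF t, of Y] by (simp add: Y)
    have int: "(tr Y has_integral (P t \<bullet> outer v)) {t..}"
      using tr_int[OF t, of Y] P_flow[OF t, of Y] by (simp add: Y has_integral_integral)
    \<comment> \<open>The solution through \<open>outer v\<close> at time \<open>t\<close> has trace
      at least its norm, which the lower energy estimate bounds by this integrand since
      \<open>outer v\<close> has norm \<open>(norm v)^2\<close>.\<close>
    have "((\<lambda>s. (norm v)\<^sup>2 * exp (- growth * (s - t))) has_integral (norm v)\<^sup>2 * (1 / growth)) {t..}"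
      by (intro has_integral_mult_right has_integral_exp_decay growth_pos)
    then have "(norm v)\<^sup>2 * (1 / growth) \<le> P t \<bullet> outer v"
    proof (rule has_integral_le[OF _ int])
      fix s assume "s \<in> {t..}"
      then have s: "t \<le> s" by simp
      have "((norm v)\<^sup>2 * exp (- growth * (s - t)))\<^sup>2 =
          exp (- 2 * growth * (s - t)) * (norm (outer v))\<^sup>2"
        by (simp add: power_mult_distrib norm_outer mult.assoc flip: exp_double)
      also have "\<dots> \<le> (norm (flow Y s))\<^sup>2"
        by (rule solution_energy(2)[OF sol t s])
      finally have "(norm v)\<^sup>2 * exp (- growth * (s - t)) \<le> norm (flow Y s)"
        by (rule power2_le_imp_le) simp
      also have "\<dots> \<le> tr Y s"
        unfolding tr_def by (rule psd_norm_le_trace[OF solution_psd[OF sol psd_outer t s]])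
      finally show "(norm v)\<^sup>2 * exp (- growth * (s - t)) \<le> tr Y s" .
    qed
    moreover have "((\<lambda>s. C * (norm v)\<^sup>2 * exp (- \<alpha> * (s - t))) has_integral
        C * (norm v)\<^sup>2 * (1 / \<alpha>)) {t..}"
      by (intro has_integral_mult_right has_integral_exp_decay \<open>\<alpha> > 0\<close>)
    then have "P t \<bullet> outer v \<le> C * (norm v)\<^sup>2 * (1 / \<alpha>)"
    proof (rule has_integral_le[OF int])
      show "tr Y s \<le> C * (norm v)\<^sup>2 * exp (- \<alpha> * (s - t))" if "s \<in> {t..}" for s
        using decay[OF t psd_outer sol, of s] that by (simp add: tr_def norm_outer)
    qed
    ultimately show ?thesis by (simp add: mult_ac)
  qed
  have P_lower: "(1 / growth) *\<^sub>R mat 1 \<preceq>\<^sub>L P t" and P_upper: "P t \<preceq>\<^sub>L (C / \<alpha>) *\<^sub>R mat 1"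
    if "0 \<le> t" for t
    using P_bounds[OF that] P_sym[OF that]
    by (auto simp: loewner_le_def psd_iff_inner_outer transpose_diff transpose_scalar inner_diff_left
        inner_mat_1_outer)
  have P_pd: "pd (P t)" if "0 \<le> t" for t
  proof -
    have "0 < v \<bullet> (P t *v v)" if "v \<noteq> 0" for v
    proof -
      have "0 < 1 / growth * (norm v)\<^sup>2"
        using growth_pos that by simp
      also have "\<dots> \<le> P t \<bullet> outer v"
        using P_bounds[OF \<open>0 \<le> t\<close>] by blast
      finally show ?thesis by (simp add: inner_outer)
    qed
    then show ?thesis
      using P_sym[OF that] by (simp add: pd_def sym_mat_def)
  qed
  have I_pd: "pd ?I"
    by (simp add: pd_def sym_mat_def)
  have I_bounds: "1 *\<^sub>R ?I \<preceq>\<^sub>L ?I" "?I \<preceq>\<^sub>L 1 *\<^sub>R ?I"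
    using psd_scaleR[OF order_refl psd_mat_1] by (simp_all add: loewner_le_def)
  show ?thesis
    unfolding lyapunov_equation_cond_def
  proof (intro exI conjI allI impI)
    \<comment> \<open>With the right-hand side itself as \<open>P'\<close>, the Lyapunov equation
      for constant \<open>Q = mat 1\<close> holds identically.\<close>
    show "differentiable_with A N \<mu> P (\<lambda>t. - adj_op A N \<mu> t (P t) + - ?I)"
      unfolding differentiable_with_def using P P' by blast
    show "continuous_on {0..} (\<lambda>_::real. ?I)"
      by (rule continuous_on_const)
    show "1 / growth > 0" "C / \<alpha> > 0"
      using growth_pos \<open>C > 0\<close> \<open>\<alpha> > 0\<close> by auto
  qed ((rule zero_less_one P_pd P_lower P_upper I_pd I_bounds, assumption?) | simp)+
qed

end

theorem theorem3p3:
  fixes A :: "nat \<Rightarrow> real \<Rightarrow> real ^ 'n ^ 'n" and \<mu> :: "real \<Rightarrow> real" and N :: nat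
    and \<nu> :: "real ^ 'n ^ 'n \<Rightarrow> real"
  assumes "matrix_norm \<nu>"
    and "\<forall>i\<le>N. piecewise_continuous (A i) \<and> bounded (A i ` {0..})"
    and "piecewise_continuous \<mu>" and "bounded (\<mu> ` {0..})"
  shows "(uniformly_exponentially_stable \<nu> A N \<mu> \<longleftrightarrow> lyapunov_equation_cond A N \<mu>) \<and>
         (lyapunov_equation_cond A N \<mu> \<longleftrightarrow> lyapunov_inequality_cond A N \<mu>)"
proof -
  interpret bounded_coefficients A N \<mu>
    by (rule bounded_coefficients.intro) (use assms(2-4) in blast)+
  have "uniformly_exponentially_stable \<nu> A N \<mu> \<Longrightarrow> lyapunov_equation_cond A N \<mu>"
    by (rule stable_imp_equation[OF assms(1)])
  moreover have "lyapunov_equation_cond A N \<mu> \<Longrightarrow> lyapunov_inequality_cond A N \<mu>"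
    by (rule equation_imp_inequality)
  moreover have "lyapunov_inequality_cond A N \<mu> \<Longrightarrow> uniformly_exponentially_stable \<nu> A N \<mu>"
    by (rule inequality_imp_stable[OF assms(1)])
  ultimately show ?thesis
    by blast
qed

end
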